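(* Suppose $E\subset\mathbb{N}$ belongs to one of the classes $\mathcal{D}^{(\infty)}$, $\mathcal{E}_{\mathrm{c.pt.}}$ or $\mathcal{E}_{\mathrm{pol}}$. Then for every irrational $\theta$, $$\sum_{n\leq x} \mathbf{1}_E(n)\,e(\theta n)=o(x)\quad (x\to\infty).$$
   Context: $\mathbb{N}=\{1,2,\ldots\}$; $\mathbf{1}_E$ is the indicator function of $E$; $e(x):=e^{2\pi i x}$ for $x\in\mathbb{R}$. A function $f\colon\mathbb{N}\to\mathbb{C}$ is multiplicative if $f(1)=1$ and $f(mn)=f(m)f(n)$ whenever $\gcd(m,n)=1$. For $r\in\mathbb{N}$, $\mathcal{D}^{(r)}$ is the collection of all sets of the form $\{n\in\mathbb{N}: f_1(n)=z_1,\ldots,f_r(n)=z_r\}$, where $f_1,\ldots,f_r\colon\mathbb{N}\to\mathbb{C}$ are arbitrary multiplicative functions and $z_1,\ldots,z_r$ are arbitrary complex numbers; $\mathcal{D}^{(\infty)}:=\bigcup_{r\geq 1}\mathcal{D}^{(r)}$. A point $z\in\mathbb{C}$ is a concentration point for $f\colon\mathbb{N}\to\mathbb{C}$ if $\sum_{p\text{ prime},\,f(p)=z}\frac1p=\infty$. $\mathcal{E}_{\mathrm{c.pt.}}$ is the collection of all sets of the form $\{n\in\mathbb{N}:f(n)\in K\}$, where $K\subset\mathbb{C}$ is arbitrary and $f\colon\mathbb{N}\to\mathbb{C}$ is a multiplicative function possessing at least one concentration point. A set $K\subset\mathbb{C}$ is an elementary set in polar coordinates if it is a finite union of sets of the form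 $\{re^{2\pi i\varphi}: r\in I_1,\varphi\in I_2\}$, where $I_1,I_2$ are (open, closed or half-open) intervals in $\mathbb{R}$. $\mathcal{E}_{\mathrm{pol}}$ is the collection of all sets of the form $\{n\in\mathbb{N}:f(n)\in K\}$, where $K$ is an elementary set in polar coordinates and $f$ is a multiplicative function bounded in modulus by $1$ with $\lim_{N\to\infty}\frac1N\sum_{n=1}^N|f(n)|\neq 0$ (this limit always exists, by Wirsing's theorem). *)

theory Defs
  imports "HOL-Analysis.Analysis" "HOL-Computational_Algebra.Primes" "HOL-Library.Landau_Symbols"
begin

text \<open>
  The positive integers are the elements \<open>n > 0\<close> of type \<^typ>\<open>nat\<close>. Arithmetic functions have
  type \<^typ>\<open>nat \<Rightarrow> complex\<close>; their value at \<open>0\<close> is arbitrary and never used.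
\<close>

definition e :: "real \<Rightarrow> complex" where
  "e x = exp (2 * complex_of_real pi * \<i> * complex_of_real x)"

definition multiplicative :: "(nat \<Rightarrow> complex) \<Rightarrow> bool" where
  "multiplicative f \<longleftrightarrow>
     f 1 = 1 \<and> (\<forall>m>0. \<forall>n>0. coprime m n \<longrightarrow> f (m * n) = f m * f n)"

definition D_class :: "nat \<Rightarrow> nat set set" where
  "D_class r =
     {{n. n > 0 \<and> (\<forall>i\<in>{1..r}. f i n = z i)} | (f :: nat \<Rightarrow> nat \<Rightarrow> complex) (z :: nat \<Rightarrow> complex).
        \<forall>i\<in>{1..r}. multiplicative (f i)}"

definition D_infinity :: "nat set set" where
  "D_infinity = (\<Union>r\<in>{1..}. D_class r)"

text \<open>The terms are nonnegative, so the series diverges to infinity iff it is not summable.\<close>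

definition concentration_point :: "(nat \<Rightarrow> complex) \<Rightarrow> complex \<Rightarrow> bool" where
  "concentration_point f z \<longleftrightarrow>
     \<not> (\<lambda>p. 1 / real p) summable_on {p. prime p \<and> f p = z}"

definition E_cpt :: "nat set set" where
  "E_cpt =
     {{n. n > 0 \<and> f n \<in> K} | (f :: nat \<Rightarrow> complex) (K :: complex set).
        multiplicative f \<and> (\<exists>z. concentration_point f z)}"

definition polar_rectangle :: "real set \<Rightarrow> real set \<Rightarrow> complex set" where
  "polar_rectangle I1 I2 = {complex_of_real r * e \<phi> | r \<phi>. r \<in> I1 \<and> \<phi> \<in> I2}"

text \<open>
  Unbounded and degenerate intervals are admitted, and \<open>r\<close> may be negative.
\<close>

definition elementary_polar :: "complex set \<Rightarrow> bool" where
  "elementary_polar K \<longleftrightarrow>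
     (\<exists>\<K>. finite \<K> \<and> K = \<Union>\<K> \<and>
        (\<forall>R\<in>\<K>. \<exists>I1 I2. is_interval I1 \<and> is_interval I2 \<and> R = polar_rectangle I1 I2))"

definition E_pol :: "nat set set" where
  "E_pol =
     {{n. n > 0 \<and> f n \<in> K} | (f :: nat \<Rightarrow> complex) (K :: complex set).
        multiplicative f \<and> (\<forall>n>0. norm (f n) \<le> 1) \<and>
        (\<exists>L. (\<lambda>N. 1 / real N * (\<Sum>n=1..N. norm (f n))) \<longlonglongrightarrow> L \<and> L \<noteq> 0) \<and>
        elementary_polar K}"

end

theory Submission
  imports Defs "HOL-Computational_Algebra.Squarefree"
begin

text \<open>
  The proof is a version of the Daboussi--Katai argument for sets whose indicator function is not
  multiplicative. By the Turan--Kubilius inequality, almost every \<open>n \<le> N\<close> has about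
  \<open>A = (\<Sum>p\<in>P. 1 / p)\<close> divisors in a given finite set \<open>P\<close> of primes. Writing \<open>S\<close> for the exponential
  sum over \<open>E \<inter> {1..N}\<close>, this makes \<open>A * S\<close> equal, up to \<open>sqrt (2 * A) * N\<close>, to the bilinear sum of
  \<open>indicator E (p * m) * e (\<theta> * p * m)\<close> over \<open>p \<in> P\<close> and \<open>m \<le> N / p\<close>. It is enough to bound the
  bilinear sum by \<open>B * N\<close> with \<open>B\<close> independent of \<open>P\<close>, provided that \<open>A\<close> can be made large.

  For \<open>p\<close> not dividing \<open>m\<close>, whether \<open>p * m\<close> lies in \<open>E\<close> depends on the values at \<open>p\<close> and at \<open>m\<close> of the
  multiplicative functions that define \<open>E\<close>. So each \<open>m\<close> selects a set of primes from a family
  parametrised by these values at \<open>m\<close>. The family may be infinite, but it is small: on every dyadic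
  block \<open>{2^j..<2^(j+1)}\<close> each of its sets differs in at most \<open>C * 2 powr ((1 - \<delta>) * j)\<close> elements
  from one of at most \<open>C * 2 powr (j / 2)\<close> model sets. This property, with any exponent in place of
  \<open>1 / 2\<close>, is called \<open>low_entropy\<close> below.

  Fix a block, replace the set selected by \<open>m\<close> by a model set \<open>\<beta> m\<close>, and apply the
  Cauchy--Schwarz inequality to the sum over the at most \<open>N / 2^j\<close> values of \<open>m\<close>. The squares that
  arise are nonnegative, so the square for the one set \<open>\<beta> m\<close> is at most the sum of the squares over
  all model sets; the model sets no longer depend on \<open>m\<close>. Expanding the squares gives geometric
  progressions in \<open>m\<close> with ratio \<open>e (\<theta> * (p - q))\<close>. Those with \<open>p \<noteq> q\<close> are bounded because \<open>\<theta>\<close> is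
  irrational, and the diagonal is \<open>O(N)\<close> for each model set. So, for large \<open>N\<close>, the block contributes
  at most \<open>N\<close> times a geometrically decaying function of \<open>j\<close>, and \<open>B\<close> is the sum of a convergent series.
  This is the orthogonality criterion \<open>exponential_sum_criterion\<close>.

  It remains to see that the families have low entropy (\<open>level_set_low_entropy\<close>). Boolean operations
  preserve low entropy. The fibres of a function have low entropy because few fibres have many
  elements in a block and the others are close to the empty set; this gives the class \<open>D_infinity\<close>.
  The preimages of intervals under a real function have low entropy because, after sorting, they are
  intervals of indices; modulus and argument then give \<open>E_pol\<close>. For \<open>E_cpt\<close> one only uses the primes
  at which \<open>f\<close> takes the value \<open>z\<close> of the concentration point, and then the selected set is empty or
  everything.
\<close>


section \<open>Predicates of low entropy on dyadic blocks\<close>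

text \<open>
A finite family \<open>G\<close> approximates, in Hamming distance on the dyadic block, all the sets cut out by the
predicates \<open>Q w\<close>; \<open>M\<close> bounds the number of model sets and \<open>d\<close> the distance.
\<close>

definition dyadic_net :: "('w \<Rightarrow> nat \<Rightarrow> bool) \<Rightarrow> nat \<Rightarrow> real \<Rightarrow> real \<Rightarrow> nat set set \<Rightarrow> bool" where
  "dyadic_net Q j M d G \<longleftrightarrow> finite G \<and> real (card G) \<le> M \<and>
     (\<forall>w. \<exists>g\<in>G. real (card {p\<in>{2^j..<2^(j+1)}. Q w p \<noteq> (p \<in> g)}) \<le> d)"

text \<open>
The number of model sets may grow like an arbitrarily small power of the block length while the
error saves some power. Quantifying over every \<open>\<epsilon>\<close> makes the notion stable under Boolean operations,
where the numbers of model sets multiply.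
\<close>

definition low_entropy :: "('w \<Rightarrow> nat \<Rightarrow> bool) \<Rightarrow> bool" where
  "low_entropy Q \<longleftrightarrow>
     (\<forall>\<epsilon>::real. 0 < \<epsilon> \<and> \<epsilon> < 1 \<longrightarrow> (\<exists>\<delta>::real. \<delta> > 0 \<and> (\<exists>C::real. \<forall>j::nat. \<exists>G.
        dyadic_net Q j (C * 2 powr (\<epsilon> * real j)) (C * 2 powr ((1 - \<delta>) * real j)) G)))"

lemma low_entropyI:
  assumes "\<And>\<epsilon>. 0 < \<epsilon> \<Longrightarrow> \<epsilon> < 1 \<Longrightarrow> \<exists>\<delta> C. \<delta> > 0 \<and>
    (\<forall>j. \<exists>G. dyadic_net Q j (C * 2 powr (\<epsilon> * real j)) (C * 2 powr ((1 - \<delta>) * real j)) G)"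
  shows "low_entropy Q"
  using assms unfolding low_entropy_def by blast

lemma low_entropyE:
  assumes "low_entropy Q" "0 < \<epsilon>" "\<epsilon> < 1"
  obtains \<delta> C G where "\<delta> > 0" "C \<ge> 0" "\<And>j::nat. finite (G j)"
    "\<And>j. real (card (G j)) \<le> C * 2 powr (\<epsilon> * real j)"
    "\<And>j w. \<exists>g\<in>G j. real (card {p\<in>{2^j..<2^(j+1)}. Q w p \<noteq> (p \<in> g)}) \<le> C * 2 powr ((1 - \<delta>) * real j)"
proof -
  obtain \<delta> C :: real where \<delta>: "\<delta> > 0" and
    ex: "\<forall>j. \<exists>G. dyadic_net Q j (C * 2 powr (\<epsilon> * real j)) (C * 2 powr ((1 - \<delta>) * real j)) G"
    using assms unfolding low_entropy_def by meson
  from choice[OF ex] obtain G where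
    G: "\<forall>j. dyadic_net Q j (C * 2 powr (\<epsilon> * real j)) (C * 2 powr ((1 - \<delta>) * real j)) (G j)"
    by blast
  have "0 \<le> real (card (G 0))" by simp
  also have "\<dots> \<le> C" using G[rule_format, of 0] by (simp add: dyadic_net_def)
  finally have "C \<ge> 0" .
  show ?thesis by (rule that[OF \<delta> \<open>C \<ge> 0\<close>, of G]) (use G in \<open>auto simp: dyadic_net_def\<close>)
qed

lemma low_entropy_reindex:
  assumes "low_entropy Q"
  shows "low_entropy (\<lambda>w. Q (u w))"
  using assms unfolding low_entropy_def dyadic_net_def by meson

text \<open>
Combining two nets of exponent \<open>\<epsilon> / 2\<close> pairwise gives a net of exponent \<open>\<epsilon>\<close>; a combination of two
sets can only be wrong where one of the two approximations is wrong, so the errors add.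
\<close>

lemma low_entropy_bool_op:
  fixes b :: "bool \<Rightarrow> bool \<Rightarrow> bool"
  assumes "low_entropy Q" "low_entropy R"
  shows "low_entropy (\<lambda>w p. b (Q w p) (R w p))"
proof (rule low_entropyI)
  fix \<epsilon> :: real assume \<epsilon>: "0 < \<epsilon>" "\<epsilon> < 1"
  then have \<epsilon>2: "0 < \<epsilon> / 2" "\<epsilon> / 2 < 1" by auto
  obtain \<delta>1 C1 G1 where 1: "\<delta>1 > 0" "C1 \<ge> 0" "\<And>j::nat. finite (G1 j)"
    "\<And>j. real (card (G1 j)) \<le> C1 * 2 powr (\<epsilon>/2 * real j)"
    "\<And>j w. \<exists>g\<in>G1 j. real (card {p\<in>{2^j..<2^(j+1)}. Q w p \<noteq> (p \<in> g)}) \<le> C1 * 2 powr ((1 - \<delta>1) * real j)"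
    by (rule low_entropyE[OF assms(1) \<epsilon>2]) blast
  obtain \<delta>2 C2 G2 where 2: "\<delta>2 > 0" "C2 \<ge> 0" "\<And>j::nat. finite (G2 j)"
    "\<And>j. real (card (G2 j)) \<le> C2 * 2 powr (\<epsilon>/2 * real j)"
    "\<And>j w. \<exists>g\<in>G2 j. real (card {p\<in>{2^j..<2^(j+1)}. R w p \<noteq> (p \<in> g)}) \<le> C2 * 2 powr ((1 - \<delta>2) * real j)"
    by (rule low_entropyE[OF assms(2) \<epsilon>2]) blast
  define \<delta> where "\<delta> = min \<delta>1 \<delta>2"
  define C where "C = C1 * C2 + C1 + C2"
  have "finite G \<and> real (card G) \<le> C * 2 powr (\<epsilon> * j) \<and>
          (\<forall>w. \<exists>g\<in>G. real (card {p\<in>{2^j..<2^(j+1)}. b (Q w p) (R w p) \<noteq> (p \<in> g)})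
                  \<le> C * 2 powr ((1 - \<delta>) * j))"
    if G: "G = (\<lambda>(g, h). {p. b (p \<in> g) (p \<in> h)}) ` (G1 j \<times> G2 j)" for j :: nat and G
  proof (intro conjI allI)
    show "finite G" unfolding G by (intro finite_imageI finite_cartesian_product 1(3) 2(3))
    have "card G \<le> card (G1 j) * card (G2 j)"
      unfolding G card_cartesian_product[symmetric]
      by (intro card_image_le finite_cartesian_product 1(3) 2(3))
    then have "real (card G) \<le> real (card (G1 j)) * real (card (G2 j))"
      by (metis of_nat_le_iff of_nat_mult)
    also have "\<dots> \<le> (C1 * 2 powr (\<epsilon>/2 * real j)) * (C2 * 2 powr (\<epsilon>/2 * real j))"
      by (intro mult_mono 1(4) 2(4)) (use 1(2) in auto)
    also have "\<dots> = C1 * C2 * (2 powr (\<epsilon>/2 * real j) * 2 powr (\<epsilon>/2 * real j))" by (simp only: mult_ac)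
    also have "\<dots> = C1 * C2 * 2 powr (\<epsilon> * j)"
      by (simp flip: powr_add)
    also have "\<dots> \<le> C * 2 powr (\<epsilon> * j)"
      unfolding C_def using 1(2) 2(2) by (intro mult_right_mono) auto
    finally show "real (card G) \<le> C * 2 powr (\<epsilon> * j)" .
    fix w
    obtain g where g: "g \<in> G1 j" "real (card {p\<in>{2^j..<2^(j+1)}. Q w p \<noteq> (p \<in> g)}) \<le> C1 * 2 powr ((1 - \<delta>1) * real j)"
      using 1(5) by blast
    obtain h where h: "h \<in> G2 j" "real (card {p\<in>{2^j..<2^(j+1)}. R w p \<noteq> (p \<in> h)}) \<le> C2 * 2 powr ((1 - \<delta>2) * real j)"
      using 2(5) by blast
    let ?k = "{p. b (p \<in> g) (p \<in> h)}"
    have "card {p\<in>{2^j..<2^(j+1)}. b (Q w p) (R w p) \<noteq> (p \<in> ?k)}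
       \<le> card ({p\<in>{2^j..<2^(j+1)}. Q w p \<noteq> (p \<in> g)} \<union> {p\<in>{2^j..<2^(j+1)}. R w p \<noteq> (p \<in> h)})"
      by (intro card_mono) (auto, (metis (full_types))+)
    also have "\<dots> \<le> card {p\<in>{2^j..<2^(j+1)}. Q w p \<noteq> (p \<in> g)} + card {p\<in>{2^j..<2^(j+1)}. R w p \<noteq> (p \<in> h)}"
      by (rule card_Un_le)
    finally have "real (card {p\<in>{2^j..<2^(j+1)}. b (Q w p) (R w p) \<noteq> (p \<in> ?k)})
       \<le> C1 * 2 powr ((1 - \<delta>1) * real j) + C2 * 2 powr ((1 - \<delta>2) * real j)"
      using g h by linarith
    also have "\<dots> \<le> C1 * 2 powr ((1 - \<delta>) * real j) + C2 * 2 powr ((1 - \<delta>) * real j)"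
      using 1(2) 2(2) by (intro add_mono mult_left_mono powr_mono mult_right_mono) (auto simp: \<delta>_def)
    also have "\<dots> \<le> C * 2 powr ((1 - \<delta>) * real j)"
      unfolding C_def using 1(2) 2(2) by (simp add: algebra_simps)
    finally have "real (card {p\<in>{2^j..<2^(j+1)}. b (Q w p) (R w p) \<noteq> (p \<in> ?k)}) \<le> C * 2 powr ((1 - \<delta>) * real j)" .
    moreover have "?k \<in> G" unfolding G using g(1) h(1) by auto
    ultimately show "\<exists>g\<in>G. real (card {p\<in>{2^j..<2^(j+1)}. b (Q w p) (R w p) \<noteq> (p \<in> g)}) \<le> C * 2 powr ((1 - \<delta>) * real j)"
      by blast
  qed
  from this[OF refl] have "\<exists>G. dyadic_net (\<lambda>w p. b (Q w p) (R w p)) j (C * 2 powr (\<epsilon> * real j)) (C * 2 powr ((1 - \<delta>) * real j)) G" for j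
    unfolding dyadic_net_def by (rule exI)
  moreover have "\<delta> > 0" using 1(1) 2(1) by (simp add: \<delta>_def)
  ultimately show "\<exists>\<delta> C. \<delta> > 0 \<and>
    (\<forall>j. \<exists>G. dyadic_net (\<lambda>w p. b (Q w p) (R w p)) j (C * 2 powr (\<epsilon> * real j)) (C * 2 powr ((1 - \<delta>) * real j)) G)"
    by blast
qed

lemmas low_entropy_conj = low_entropy_bool_op[where b = "(\<and>)"]
lemmas low_entropy_disj = low_entropy_bool_op[where b = "(\<or>)"]

lemma low_entropy_finite_family:
  assumes "finite G" "\<And>w. \<exists>g\<in>G. \<forall>p. Q w p \<longleftrightarrow> p \<in> g"
  shows "low_entropy Q"
proof (rule low_entropyI)
  fix \<epsilon> :: real assume \<epsilon>: "0 < \<epsilon>" "\<epsilon> < 1"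
  have "finite G \<and> real (card G) \<le> real (card G) * 2 powr (\<epsilon> * j) \<and>
          (\<forall>w. \<exists>g\<in>G. real (card {p\<in>{2^j..<2^(j+1)}. Q w p \<noteq> (p \<in> g)})
                  \<le> real (card G) * 2 powr ((1 - 1) * real j))" for j :: nat
  proof (intro conjI allI)
    have "1 \<le> 2 powr (\<epsilon> * j)" using \<epsilon> by (simp add: ge_one_powr_ge_zero)
    then show "real (card G) \<le> real (card G) * 2 powr (\<epsilon> * j)"
      by (simp add: mult_le_cancel_left1)
    fix w
    obtain g where "g \<in> G" "\<forall>p. Q w p \<longleftrightarrow> p \<in> g" using assms(2) by blast
    then show "\<exists>g\<in>G. real (card {p\<in>{2^j..<2^(j+1)}. Q w p \<noteq> (p \<in> g)}) \<le> real (card G) * 2 powr ((1 - 1) * real j)"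
      by (intro bexI[of _ g]) auto
  qed (fact assms(1))
  then have net: "\<exists>H. dyadic_net (\<lambda>w p. Q w p) j (real (card G) * 2 powr (\<epsilon> * real j)) (real (card G) * 2 powr ((1 - 1) * real j)) H" for j
    unfolding dyadic_net_def by (intro exI[of _ G])
  show "\<exists>\<delta> C. \<delta> > 0 \<and>
    (\<forall>j. \<exists>G. dyadic_net (\<lambda>w p. Q w p) j (C * 2 powr (\<epsilon> * real j)) (C * 2 powr ((1 - \<delta>) * real j)) G)"
    by (rule exI[of _ "1::real"], rule exI[of _ "real (card G)"], intro conjI allI net zero_less_one)
qed

lemma low_entropy_const: "low_entropy (\<lambda>w p. R p)"
  by (rule low_entropy_finite_family[of "{{p. R p}}"]) auto

lemma low_entropy_param: "low_entropy (\<lambda>w p. R w)"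
  by (rule low_entropy_finite_family[of "{{}, UNIV}"]) auto

lemma low_entropy_finite_Ex:
  assumes "finite S" "\<And>s. s \<in> S \<Longrightarrow> low_entropy (Q s)"
  shows "low_entropy (\<lambda>w p. \<exists>s\<in>S. Q s w p)"
  using assms
proof (induction S rule: finite_induct)
  case empty
  show ?case using low_entropy_const[of "\<lambda>p. False"] by simp
next
  case (insert s S)
  then have "low_entropy (\<lambda>w p. Q s w p \<or> (\<exists>s\<in>S. Q s w p))"
    by (intro low_entropy_disj) auto
  then show ?case by simp
qed

lemma low_entropy_finite_All:
  assumes "finite S" "\<And>s. s \<in> S \<Longrightarrow> low_entropy (Q s)"
  shows "low_entropy (\<lambda>w p. \<forall>s\<in>S. Q s w p)"
  using assms
proof (induction S rule: finite_induct)
  case empty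
  show ?case using low_entropy_const[of "\<lambda>p. True"] by simp
next
  case (insert s S)
  then have "low_entropy (\<lambda>w p. Q s w p \<and> (\<forall>s\<in>S. Q s w p))"
    by (intro low_entropy_conj) auto
  then show ?case by simp
qed

text \<open>
At most \<open>2 powr (\<epsilon> * j)\<close> fibres have more than \<open>2 powr ((1 - \<epsilon>) * j)\<close> elements in the block, since fibres
are disjoint. These serve as their own models, and the empty set is a model for all the others.
\<close>

lemma low_entropy_fibre: "low_entropy (\<lambda>w p. h p = w)"
proof (rule low_entropyI)
  fix \<epsilon> :: real assume \<epsilon>: "0 < \<epsilon>" "\<epsilon> < 1"
  have "finite G \<and> real (card G) \<le> 2 * 2 powr (\<epsilon> * j) \<and>
          (\<forall>w. \<exists>g\<in>G. real (card {p\<in>{2^j..<2^(j+1)}. (h p = w) \<noteq> (p \<in> g)})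
                  \<le> 2 * 2 powr ((1 - \<epsilon>) * j))"
    if P: "P = {2^j..<2^(j+1)}"
      and W: "W = {w. real (card {p\<in>P. h p = w}) > 2 powr ((1 - \<epsilon>) * j)}"
      and G: "G = insert {} ((\<lambda>w. {p. h p = w}) ` W)" for j :: nat and P W and G :: "nat set set"
  proof -
    have finP: "finite P" and cardP: "card P = 2 ^ j" by (auto simp: P)
    have "W \<subseteq> h ` P"
    proof
      fix w assume "w \<in> W"
      then have "real (card {p\<in>P. h p = w}) > 0"
        unfolding W using less_trans[OF powr_gt_zero[THEN iffD2]] by fastforce
      then have "{p\<in>P. h p = w} \<noteq> {}" by (metis card.empty of_nat_0 less_irrefl)
      then show "w \<in> h ` P" by auto
    qed
    then have finW: "finite W" using finP finite_surj by blast
    have "real (card W) * 2 powr ((1 - \<epsilon>) * j) = (\<Sum>w\<in>W. 2 powr ((1 - \<epsilon>) * j))" by simp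
    also have "\<dots> \<le> (\<Sum>w\<in>W. real (card {p\<in>P. h p = w}))"
      by (intro sum_mono) (simp add: W)
    also have "\<dots> = real (card (\<Union>w\<in>W. {p\<in>P. h p = w}))"
      using finW finP by (subst card_UN_disjoint) auto
    also have "\<dots> \<le> real (card P)"
      using finP by (intro of_nat_mono card_mono) auto
    also have "\<dots> = 2 powr (\<epsilon> * j) * 2 powr ((1 - \<epsilon>) * j)"
      by (simp add: cardP algebra_simps flip: powr_add powr_realpow)
    finally have cW: "real (card W) \<le> 2 powr (\<epsilon> * j)" by simp
    have "card G \<le> Suc (card ((\<lambda>w. {p. h p = w}) ` W))"
      unfolding G by (rule card_insert_le_m1) auto
    then have "real (card G) \<le> 1 + real (card W)"
      using card_image_le[OF finW, of "\<lambda>w. {p. h p = w}"] by linarith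
    moreover have "1 \<le> 2 powr (\<epsilon> * j)" using \<epsilon> by (simp add: ge_one_powr_ge_zero)
    ultimately have "real (card G) \<le> 2 * 2 powr (\<epsilon> * j)" using cW by linarith
    moreover have "\<exists>g\<in>G. real (card {p\<in>P. (h p = w) \<noteq> (p \<in> g)}) \<le> 2 * 2 powr ((1 - \<epsilon>) * j)" for w
    proof (cases "w \<in> W")
      case True
      then show ?thesis unfolding G by (intro bexI[of _ "{p. h p = w}"]) auto
    next
      case False
      then have "real (card {p\<in>P. h p = w}) \<le> 2 powr ((1 - \<epsilon>) * j)" by (simp add: W)
      then have "real (card {p\<in>P. h p = w}) \<le> 2 * 2 powr ((1 - \<epsilon>) * j)"
        by (smt (verit) powr_ge_zero)
      then show ?thesis unfolding G by (intro bexI[of _ "{}"]) auto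
    qed
    ultimately show ?thesis using finW unfolding P[symmetric] by (simp add: G)
  qed
  from this[OF refl refl refl] have net: "\<exists>G. dyadic_net (\<lambda>w p. h p = w) j (2 * 2 powr (\<epsilon> * real j)) (2 * 2 powr ((1 - \<epsilon>) * real j)) G" for j
    unfolding dyadic_net_def by (intro exI)
  show "\<exists>\<delta> C. \<delta> > 0 \<and>
    (\<forall>j. \<exists>G. dyadic_net (\<lambda>w p. h p = w) j (C * 2 powr (\<epsilon> * real j)) (C * 2 powr ((1 - \<delta>) * real j)) G)"
    by (rule exI[of _ "\<epsilon>"], rule exI[of _ "2::real"], intro conjI allI net \<epsilon>(1))
qed

lemma nat_convex_set_is_interval:
  fixes S :: "nat set"
  assumes "S \<subseteq> {..<N}" "\<And>i j k. i \<in> S \<Longrightarrow> k \<in> S \<Longrightarrow> i \<le> j \<Longrightarrow> j \<le> k \<Longrightarrow> j \<in> S"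
  shows "\<exists>a b. a \<le> b \<and> b \<le> N \<and> S = {a..<b}"
proof (cases "S = {}")
  case True
  then show ?thesis by (intro exI[of _ 0]) simp
next
  case False
  have fin: "finite S" using assms(1) finite_subset by blast
  have "Min S \<in> S" "Max S \<in> S" using fin False by auto
  moreover have "S = {Min S..<Suc (Max S)}"
  proof
    show "S \<subseteq> {Min S..<Suc (Max S)}" using fin by (auto simp: less_Suc_eq_le)
    show "{Min S..<Suc (Max S)} \<subseteq> S" using assms(2)[OF \<open>Min S \<in> S\<close> \<open>Max S \<in> S\<close>] by auto
  qed
  moreover have "Min S \<le> Suc (Max S)" using fin False by (simp add: le_SucI)
  moreover have "Suc (Max S) \<le> N" using \<open>Max S \<in> S\<close> assms(1) by auto
  ultimately show ?thesis by blast
qed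

text \<open>
List \<open>P\<close> in the order of increasing \<open>h\<close>. The preimage of an interval is then a range of indices, and
moving its two ends down to multiples of \<open>t\<close> affects at most \<open>2 * t\<close> indices.
Sorting a list, rather than comparing values of \<open>h\<close>, takes care of ties.
\<close>

lemma interval_preimages_coarse:
  fixes h :: "'a \<Rightarrow> real"
  assumes "finite P" "t > 0"
  shows "\<exists>G. finite G \<and> card G \<le> (card P div t + 1)\<^sup>2 \<and>
     (\<forall>I. is_interval I \<longrightarrow> (\<exists>g\<in>G. card {p\<in>P. (h p \<in> I) \<noteq> (p \<in> g)} \<le> 2 * t))"
proof -
  obtain ys where ys: "set ys = P" "distinct ys" using finite_distinct_list[OF assms(1)] by blast
  define xs where "xs = sort_key h ys"
  define N where "N = card P"
  have xs: "set xs = P" "distinct xs" "sorted (map h xs)" using ys by (auto simp: xs_def)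
  have len: "length xs = N" using distinct_card[OF xs(2)] by (simp add: N_def xs(1))
  have mono: "h (xs ! i) \<le> h (xs ! k)" if "i \<le> k" "k < N" for i k
    using sorted_nth_mono[OF xs(3), of i k] that len by simp
  define cell where "cell = (\<lambda>(u, v). (!) xs ` ({t * u..<t * v} \<inter> {..<N}))"
  define G where "G = cell ` ({..N div t} \<times> {..N div t})"
  have fG: "finite G" by (simp add: G_def)
  have "card G \<le> card ({..N div t} \<times> {..N div t})" unfolding G_def by (intro card_image_le) auto
  then have cG: "card G \<le> (N div t + 1)\<^sup>2" by (simp add: card_cartesian_product power2_eq_square)
  have "\<exists>g\<in>G. card {p\<in>P. (h p \<in> I) \<noteq> (p \<in> g)} \<le> 2 * t" if I: "is_interval I" for I
  proof -
    let ?S = "{i. i < N \<and> h (xs ! i) \<in> I}"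
    have convex: "j \<in> ?S" if "i \<in> ?S" "k \<in> ?S" "i \<le> j" "j \<le> k" for i j k
    proof -
      have "j < N" using that by simp
      moreover have "h (xs ! j) \<in> I"
        by (rule mem_is_interval_1_I[OF I, of "h (xs ! i)" "h (xs ! k)"]) (use that mono in auto)
      ultimately show ?thesis by simp
    qed
    have "\<exists>a b. a \<le> b \<and> b \<le> N \<and> ?S = {a..<b}"
    proof (rule nat_convex_set_is_interval)
      show "?S \<subseteq> {..<N}" by auto
    qed (rule convex)
    then obtain a b where ab: "a \<le> b" "b \<le> N" "?S = {a..<b}" by (elim exE conjE)
    define u v where "u = a div t" and "v = b div t"
    have u: "t * u \<le> a" "a < t * u + t" and v: "t * v \<le> b" "b < t * v + t"
      using assms(2) unfolding u_def v_def
      by (metis times_div_less_eq_dividend, metis dividend_less_times_div add.commute,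
          metis times_div_less_eq_dividend, metis dividend_less_times_div add.commute)
    have "u \<le> N div t" "v \<le> N div t" using ab(1,2) unfolding u_def v_def by (simp_all add: div_le_mono)
    then have cell: "cell (u, v) \<in> G" by (auto simp: G_def)
    have "{p\<in>P. (h p \<in> I) \<noteq> (p \<in> cell (u, v))} \<subseteq> (!) xs ` ({t * u..<t * u+t} \<union> {t * v..<t * v+t})"
    proof
      fix p assume p: "p \<in> {p\<in>P. (h p \<in> I) \<noteq> (p \<in> cell (u, v))}"
      then obtain i where i: "i < N" "p = xs ! i" using xs(1) len by (metis (no_types, lifting) in_set_conv_nth mem_Collect_eq)
      have 1: "h p \<in> I \<longleftrightarrow> i \<in> {a..<b}" unfolding ab(3)[symmetric] i(2) using i(1) by simp
      have 2: "p \<in> cell (u, v) \<longleftrightarrow> i \<in> {t * u..<t * v}"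
        using i xs(2) len by (auto simp: cell_def nth_eq_iff_index_eq)
      have "i \<in> {t * u..<t * u+t} \<union> {t * v..<t * v+t}"
        using p 1 2 u v by auto
      then show "p \<in> (!) xs ` ({t * u..<t * u+t} \<union> {t * v..<t * v+t})" using i by blast
    qed
    then have "card {p\<in>P. (h p \<in> I) \<noteq> (p \<in> cell (u, v))} \<le> card ((!) xs ` ({t * u..<t * u+t} \<union> {t * v..<t * v+t}))"
      by (intro card_mono) auto
    also have "\<dots> \<le> card ({t * u..<t * u+t} \<union> {t * v..<t * v+t})" by (intro card_image_le) auto
    also have "\<dots> \<le> 2 * t" using card_Un_le[of "{t * u..<t * u+t}" "{t * v..<t * v+t}"] by simp
    finally show ?thesis using cell by blast
  qed
  then show ?thesis using fG cG unfolding N_def by blast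
qed

text \<open>
Use the previous lemma with a step \<open>t\<close> of about \<open>2 powr ((1 - \<epsilon> / 2) * j)\<close>: this leaves
\<open>2 powr (\<epsilon> / 2 * j)\<close> positions for each of the two ends.
\<close>

lemma low_entropy_interval:
  fixes h :: "nat \<Rightarrow> real"
  assumes "\<And>w. is_interval (I w)"
  shows "low_entropy (\<lambda>w p. h p \<in> I w)"
proof (rule low_entropyI)
  fix \<epsilon> :: real assume \<epsilon>: "0 < \<epsilon>" "\<epsilon> < 1"
  define \<delta> where "\<delta> = \<epsilon> / 2"
  have \<delta>: "0 < \<delta>" "\<delta> < 1" using \<epsilon> by (auto simp: \<delta>_def)
  have "\<exists>G. finite G \<and> real (card G) \<le> 4 * 2 powr (\<epsilon> * j) \<and>
          (\<forall>w. \<exists>g\<in>G. real (card {p\<in>{2^j..<2^(j+1)}. (h p \<in> I w) \<noteq> (p \<in> g)})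
                  \<le> 4 * 2 powr ((1 - \<delta>) * j))" for j :: nat
  proof -
    define r where "r = 2 powr ((1 - \<delta>) * j)"
    define t where "t = nat \<lceil>r\<rceil>"
    have r: "r \<ge> 1" using \<delta> by (simp add: r_def ge_one_powr_ge_zero)
    have t: "t > 0" "r \<le> real t" "real t \<le> 2 * r" using r by (simp_all add: t_def) linarith+
    obtain G where G: "finite G" "card G \<le> (card {2^j..<(2::nat)^(j+1)} div t + 1)\<^sup>2"
      "\<forall>I. is_interval I \<longrightarrow> (\<exists>g\<in>G. card {p\<in>{2^j..<2^(j+1)}. (h p \<in> I) \<noteq> (p \<in> g)} \<le> 2 * t)"
      using interval_preimages_coarse[of "{2^j..<(2::nat)^(j+1)}" t h] t(1) by blast
    have c: "card {2^j..<(2::nat)^(j+1)} = 2 ^ j" by simp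
    have "real (2 ^ j div t) \<le> 2 ^ j / real t" using of_nat_div_le_of_nat[of "2^j" t, where 'a = real] by simp
    also have "\<dots> \<le> 2 ^ j / r" using t r by (intro divide_left_mono) auto
    also have "\<dots> = 2 powr (\<delta> * j)"
      by (simp add: r_def algebra_simps flip: powr_realpow powr_diff)
    finally have "real (2 ^ j div t + 1) \<le> 2 powr (\<delta> * j) + 1" by simp
    also have "\<dots> \<le> 2 * 2 powr (\<delta> * j)" using \<delta> by (simp add: ge_one_powr_ge_zero)
    finally have "(real (2 ^ j div t + 1))\<^sup>2 \<le> (2 * 2 powr (\<delta> * j))\<^sup>2" by (intro power_mono) auto
    also have "\<dots> = 4 * 2 powr (\<epsilon> * j)"
      by (simp add: power2_eq_square \<delta>_def flip: powr_add)
    finally have "real (card G) \<le> 4 * 2 powr (\<epsilon> * j)"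
      using G(2) unfolding c by (smt (verit) of_nat_mono of_nat_power)
    moreover have "\<exists>g\<in>G. real (card {p\<in>{2^j..<2^(j+1)}. (h p \<in> I w) \<noteq> (p \<in> g)}) \<le> 4 * 2 powr ((1 - \<delta>) * j)" for w
    proof -
      obtain g where "g \<in> G" "card {p\<in>{2^j..<2^(j+1)}. (h p \<in> I w) \<noteq> (p \<in> g)} \<le> 2 * t"
        using G(3) assms by blast
      then show ?thesis using t(3) unfolding r_def by (intro bexI[of _ g]) auto
    qed
    ultimately show ?thesis using G(1) by blast
  qed
  then have net: "\<exists>G. dyadic_net (\<lambda>w p. h p \<in> I w) j (4 * 2 powr (\<epsilon> * real j)) (4 * 2 powr ((1 - \<delta>) * real j)) G" for j
    unfolding dyadic_net_def .
  show "\<exists>\<delta> C. \<delta> > 0 \<and>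
    (\<forall>j. \<exists>G. dyadic_net (\<lambda>w p. h p \<in> I w) j (C * 2 powr (\<epsilon> * real j)) (C * 2 powr ((1 - \<delta>) * real j)) G)"
    by (rule exI[of _ "\<delta>"], rule exI[of _ "4::real"], intro conjI allI net \<delta>(1))
qed

text \<open>
For \<open>z \<noteq> 0\<close> these sets are fibres of \<open>f\<close>; for \<open>z = 0\<close> the condition on \<open>p\<close> is either void or \<open>f p = 0\<close>.
\<close>

lemma low_entropy_value:
  fixes f :: "nat \<Rightarrow> complex" and u :: "'w \<Rightarrow> complex"
  shows "low_entropy (\<lambda>w p. f p * u w = z)"
proof (cases "z = 0")
  case True
  have "low_entropy (\<lambda>w p. f p = 0 \<or> u w = 0)"
    by (intro low_entropy_disj low_entropy_const low_entropy_param)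
  then show ?thesis using True by simp
next
  case False
  have "low_entropy (\<lambda>w p. u w \<noteq> 0 \<and> f p = z / u w)"
    by (intro low_entropy_conj low_entropy_param low_entropy_reindex[OF low_entropy_fibre])
  moreover have "f p * u w = z \<longleftrightarrow> u w \<noteq> 0 \<and> f p = z / u w" for w p
    using False by (auto simp: field_simps)
  ultimately show ?thesis by simp
qed

section \<open>Additive characters and mean squares over a dyadic block\<close>

lemma e_add: "e (x + y) = e x * e y"
  by (simp add: e_def algebra_simps flip: exp_add)

lemma norm_e [simp]: "norm (e x) = 1"
  by (simp add: e_def norm_exp_eq_Re)

lemma cnj_e: "cnj (e x) = e (- x)"
  by (simp add: e_def exp_cnj)

lemma e_mult_of_nat: "e (x * real m) = e x ^ m"
  by (simp add: e_def exp_of_nat_mult[symmetric] mult_ac)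

lemma e_eq_1_iff: "e x = 1 \<longleftrightarrow> x \<in> \<int>"
proof
  assume "e x = 1"
  then obtain n :: int where "2 * pi * x = of_int (2 * n) * pi"
    unfolding e_def exp_eq_1 by auto
  then have "x = of_int n" by simp
  then show "x \<in> \<int>" by simp
next
  assume "x \<in> \<int>"
  then obtain n :: int where "x = of_int n" by (auto elim: Ints_cases)
  then show "e x = 1" unfolding e_def exp_eq_1 by auto
qed

lemma norm_sum_e_le:
  assumes "e \<alpha> \<noteq> 1"
  shows "norm (\<Sum>m=1..M. e (\<alpha> * real m)) \<le> 2 / norm (1 - e \<alpha>)"
proof (cases "M = 0")
  case False
  have "(\<Sum>m=1..M. e (\<alpha> * real m)) = (e \<alpha> ^ 1 - e \<alpha> ^ Suc M) / (1 - e \<alpha>)"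
    unfolding e_mult_of_nat sum_gp using assms False by auto
  then have "norm (\<Sum>m=1..M. e (\<alpha> * real m)) = norm (e \<alpha> ^ 1 - e \<alpha> ^ Suc M) / norm (1 - e \<alpha>)"
    by (simp only: norm_divide)
  also have "\<dots> \<le> (norm (e \<alpha> ^ 1) + norm (e \<alpha> ^ Suc M)) / norm (1 - e \<alpha>)"
    by (intro divide_right_mono norm_triangle_ineq4) auto
  also have "\<dots> = 2 / norm (1 - e \<alpha>)" by (simp add: norm_power norm_mult)
  finally show ?thesis .
qed simp

text \<open>
Expanding the square, each pair \<open>p \<noteq> q\<close> contributes a geometric progression with ratio
\<open>e (\<theta> * (p - q)) \<noteq> 1\<close>, which is bounded uniformly in its length. The cut-off \<open>p * m \<le> N\<close> only
shortens these progressions, which is why \<open>K\<close> does not depend on \<open>N\<close>.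
\<close>

lemma mean_square_dilates_le:
  assumes "\<theta> \<notin> \<rat>" "finite B" "0 \<notin> B"
  shows "\<exists>K\<ge>0. \<forall>N L. (\<Sum>m=1..L. (norm (\<Sum>p\<in>B. if p * m \<le> N then e (\<theta> * real (p * m)) else 0))\<^sup>2)
       \<le> real (card B) * real L + K"
proof -
  define \<kappa> where "\<kappa> = (\<lambda>p q :: nat. 2 / norm (1 - e (\<theta> * (real p - real q))))"
  define K where "K = (\<Sum>p\<in>B. \<Sum>q\<in>B. \<kappa> p q)"
  have K: "K \<ge> 0" by (simp add: K_def \<kappa>_def sum_nonneg)
  have "(\<Sum>m=1..L. (norm (\<Sum>p\<in>B. if p * m \<le> N then e (\<theta> * real (p * m)) else 0))\<^sup>2)
       \<le> real (card B) * real L + K" for N L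
  proof -
    define c where "c = (\<lambda>p m :: nat. if p * m \<le> N then e (\<theta> * real (p * m)) else 0)"
    have inner: "norm (\<Sum>m=1..L. c p m * cnj (c q m)) \<le> (if p = q then real L else 0) + \<kappa> p q"
      if pq: "p \<in> B" "q \<in> B" for p q
    proof (cases "p = q")
      case True
      have "norm (c p m * cnj (c q m)) \<le> 1" for m by (simp add: c_def norm_mult)
      then have "norm (\<Sum>m=1..L. c p m * cnj (c q m)) \<le> (\<Sum>m=1..L. 1)"
        by (intro sum_norm_le)
      moreover have "\<kappa> p q \<ge> 0" by (simp add: \<kappa>_def)
      ultimately show ?thesis using True by simp
    next
      case False
      define \<alpha> where "\<alpha> = \<theta> * (real p - real q)"
    \<comment> \<open>Among \<open>m \<in> {1..L}\<close>, the product of the two truncated terms is nonzero exactly for \<open>m \<le> M\<close>.\<close>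
      define M where "M = min L (min (N div p) (N div q))"
      have pos: "p > 0" "q > 0" using pq assms(3) by (auto intro!: Nat.gr0I)
      have "\<alpha> \<notin> \<int>"
      proof
        assume "\<alpha> \<in> \<int>"
        then have "\<alpha> / (real p - real q) \<in> \<rat>"
          using Ints_subset_Rats by (intro Rats_divide Rats_diff) auto
        then show False using False assms(1) by (simp add: \<alpha>_def)
      qed
      then have ne: "e \<alpha> \<noteq> 1" by (simp add: e_eq_1_iff)
      have "(\<Sum>m=1..L. c p m * cnj (c q m)) = (\<Sum>m=1..M. e (\<alpha> * real m))"
      proof (rule sum.mono_neutral_cong_right)
        show "{1..M} \<subseteq> {1..L}" by (auto simp: M_def)
        show "\<forall>m\<in>{1..L} - {1..M}. c p m * cnj (c q m) = 0"
          using pos by (auto simp: M_def c_def less_eq_div_iff_mult_less_eq mult.commute)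
        fix m assume "m \<in> {1..M}"
        then have "p * m \<le> N" "q * m \<le> N"
          using pos by (auto simp: M_def less_eq_div_iff_mult_less_eq mult.commute)
        then show "c p m * cnj (c q m) = e (\<alpha> * real m)"
          by (simp add: c_def cnj_e \<alpha>_def algebra_simps flip: e_add)
      qed simp
      then show ?thesis using norm_sum_e_le[OF ne, of M] False by (simp add: \<kappa>_def \<alpha>_def)
    qed
    have "complex_of_real (\<Sum>m=1..L. (norm (\<Sum>p\<in>B. c p m))\<^sup>2) = (\<Sum>m=1..L. (\<Sum>p\<in>B. c p m) * cnj (\<Sum>q\<in>B. c q m))"
      by (simp only: of_real_sum complex_norm_square)
    also have "\<dots> = (\<Sum>m=1..L. \<Sum>p\<in>B. \<Sum>q\<in>B. c p m * cnj (c q m))"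
      by (simp only: cnj_sum sum_product)
    also have "\<dots> = (\<Sum>p\<in>B. \<Sum>m=1..L. \<Sum>q\<in>B. c p m * cnj (c q m))" by (rule sum.swap)
    also have "\<dots> = (\<Sum>p\<in>B. \<Sum>q\<in>B. \<Sum>m=1..L. c p m * cnj (c q m))"
      by (intro sum.cong refl sum.swap)
    finally have eq: "complex_of_real (\<Sum>m=1..L. (norm (\<Sum>p\<in>B. c p m))\<^sup>2) = \<dots>" .
    have "(\<Sum>m=1..L. (norm (\<Sum>p\<in>B. c p m))\<^sup>2) = norm (complex_of_real (\<Sum>m=1..L. (norm (\<Sum>p\<in>B. c p m))\<^sup>2))"
      by (simp only: norm_of_real abs_of_nonneg sum_nonneg zero_le_power2)
    also have "\<dots> \<le> (\<Sum>p\<in>B. \<Sum>q\<in>B. (if p = q then real L else 0) + \<kappa> p q)"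
      unfolding eq by (intro sum_norm_le inner)
    also have "\<dots> = real (card B) * real L + K"
      using assms(2) by (simp add: sum.distrib K_def)
    finally show ?thesis unfolding c_def .
  qed
  with K show ?thesis by (intro exI[of _ K] conjI allI)
qed

text \<open>
This step decouples \<open>p\<close> from \<open>m\<close>. The set \<open>\<beta> m\<close> varies with \<open>m\<close> in an uncontrolled way, so no
cancellation in \<open>m\<close> is visible. After Cauchy--Schwarz, positivity permits replacing the one square
that belongs to \<open>\<beta> m\<close> by the sum of the squares over all of \<open>G\<close>, and every summand is then a mean
square with a fixed set of primes. The price is the factor \<open>card G\<close>, which is affordable
as long as it is smaller than the length \<open>2^j\<close> of the block.
\<close>

lemma net_exponential_sum_le:
  assumes "\<theta> \<notin> \<rat>" "P \<subseteq> {2^j..<2^(j+1)}" "finite G" "\<And>m. \<beta> m \<in> G"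
    and card: "real (card G) \<le> C * 2 powr (real j / 2)"
  obtains K :: real where
    "\<And>N. real N \<ge> K \<Longrightarrow> norm (\<Sum>p\<in>P. \<Sum>m=1..N div p. if p \<in> \<beta> m then e (\<theta> * real (p * m)) else 0)
       \<le> sqrt (2 * C) * 2 powr (- real j / 4) * real N"
proof -
  have finP: "finite P" using assms(2) finite_subset by blast
  have Ppos: "p > 0" if "p \<in> P" for p using that assms(2) by (auto intro!: Nat.gr0I)
  define T where "T = (\<lambda>N B m. \<Sum>p\<in>B. if p * m \<le> N then e (\<theta> * real (p * m)) else 0)"
  have "\<exists>K\<ge>0. \<forall>N L. (\<Sum>m=1..L. (norm (T N (P \<inter> g) m))\<^sup>2) \<le> real (card (P \<inter> g)) * real L + K" for g
  proof -
    have "finite (P \<inter> g)" "0 \<notin> P \<inter> g" using finP Ppos by auto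
    from mean_square_dilates_le[OF assms(1) this] show ?thesis unfolding T_def .
  qed
  then have "\<forall>g. \<exists>K\<ge>0. \<forall>N L. (\<Sum>m=1..L. (norm (T N (P \<inter> g) m))\<^sup>2) \<le> real (card (P \<inter> g)) * real L + K"
    by (rule allI)
  from choice[OF this] obtain \<kappa> where \<kappa>: "\<And>g. \<kappa> g \<ge> 0"
    "\<And>g N L. (\<Sum>m=1..L. (norm (T N (P \<inter> g) m))\<^sup>2) \<le> real (card (P \<inter> g)) * real L + \<kappa> g"
    by auto
  define K where "K = (\<Sum>g\<in>G. \<kappa> g)"
  have \<kappa>K: "\<kappa> g \<le> K" if "g \<in> G" for g
    unfolding K_def using that assms(3) \<kappa>(1) by (intro member_le_sum) auto
  have "norm (\<Sum>p\<in>P. \<Sum>m=1..N div p. if p \<in> \<beta> m then e (\<theta> * real (p * m)) else 0)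
       \<le> sqrt (2 * C) * 2 powr (- real j / 4) * real N" if N: "real N \<ge> K" for N
  proof -
    define L where "L = N div 2^j"
    have L: "real L \<le> real N / 2^j" "2^j * real L \<le> real N"
    proof -
      show "real L \<le> real N / 2^j" using of_nat_div_le_of_nat[of N "2^j", where 'a = real] by (simp add: L_def)
      then show "2^j * real L \<le> real N" by (simp add: field_simps)
    qed
    have "(\<Sum>m=1..N div p. if p \<in> \<beta> m then e (\<theta> * real (p * m)) else 0)
        = (\<Sum>m=1..L. if p \<in> \<beta> m \<and> p * m \<le> N then e (\<theta> * real (p * m)) else 0)" if "p \<in> P" for p
    proof (rule sum.mono_neutral_cong_left)
      have "2 ^ j \<le> p" using that assms(2) by auto
      then have "N div p \<le> L" unfolding L_def by (intro div_le_mono2) auto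
      then show "{1..N div p} \<subseteq> {1..L}" by auto
      show "\<forall>m\<in>{1..L} - {1..N div p}. (if p \<in> \<beta> m \<and> p * m \<le> N then e (\<theta> * real (p * m)) else 0) = 0"
        using Ppos[OF that] by (auto simp: less_eq_div_iff_mult_less_eq mult.commute)
      fix m assume "m \<in> {1..N div p}"
      then have "p * m \<le> N" using Ppos[OF that] by (auto simp: less_eq_div_iff_mult_less_eq mult.commute)
      then show "(if p \<in> \<beta> m then e (\<theta> * real (p * m)) else 0) = (if p \<in> \<beta> m \<and> p * m \<le> N then e (\<theta> * real (p * m)) else 0)"
        by simp
    qed simp
    then have "(\<Sum>p\<in>P. \<Sum>m=1..N div p. if p \<in> \<beta> m then e (\<theta> * real (p * m)) else 0)
       = (\<Sum>p\<in>P. \<Sum>m=1..L. if p \<in> \<beta> m \<and> p * m \<le> N then e (\<theta> * real (p * m)) else 0)"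
      by (rule sum.cong[OF refl])
    also have "\<dots> = (\<Sum>m=1..L. \<Sum>p\<in>P. if p \<in> \<beta> m \<and> p * m \<le> N then e (\<theta> * real (p * m)) else 0)"
      by (rule sum.swap)
    also have "\<dots> = (\<Sum>m=1..L. T N (P \<inter> \<beta> m) m)"
      unfolding T_def sum.inter_restrict[OF finP] by (intro sum.cong refl) auto
    finally have "norm (\<Sum>p\<in>P. \<Sum>m=1..N div p. if p \<in> \<beta> m then e (\<theta> * real (p * m)) else 0)
       \<le> (\<Sum>m=1..L. norm (T N (P \<inter> \<beta> m) m))" (is "?S \<le> ?R")
      by (simp add: sum_norm_le)
    then have "?S\<^sup>2 \<le> ?R\<^sup>2" by (intro power_mono) auto
    also have "\<dots> \<le> (\<Sum>m=1..L. (norm (T N (P \<inter> \<beta> m) m))\<^sup>2) * real L"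
      using sum_squared_le_sum_of_squares[of "\<lambda>m. norm (T N (P \<inter> \<beta> m) m)" "{1..L}"] by simp
    also have "\<dots> \<le> (\<Sum>m=1..L. \<Sum>g\<in>G. (norm (T N (P \<inter> g) m))\<^sup>2) * real L"
    proof (intro mult_right_mono sum_mono)
      fix m
      show "(norm (T N (P \<inter> \<beta> m) m))\<^sup>2 \<le> (\<Sum>g\<in>G. (norm (T N (P \<inter> g) m))\<^sup>2)"
        by (rule member_le_sum[of "\<beta> m" G "\<lambda>g. (norm (T N (P \<inter> g) m))\<^sup>2"]) (use assms(3,4) in auto)
    qed auto
    also have "\<dots> = (\<Sum>g\<in>G. \<Sum>m=1..L. (norm (T N (P \<inter> g) m))\<^sup>2) * real L"
      by (subst sum.swap) (rule refl)
    also have "\<dots> \<le> (\<Sum>g\<in>G. 2 * real N) * real L"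
    proof (intro mult_right_mono sum_mono)
      fix g assume g: "g \<in> G"
      have "card (P \<inter> g) \<le> card {2^j..<(2::nat)^(j+1)}"
        using assms(2) by (intro card_mono) auto
      then have "card (P \<inter> g) \<le> 2 ^ j" by simp
      then have "real (card (P \<inter> g)) \<le> 2^j" using of_nat_mono by fastforce
      then have "real (card (P \<inter> g)) * real L \<le> 2^j * real L" by (intro mult_right_mono) auto
      then show "(\<Sum>m=1..L. (norm (T N (P \<inter> g) m))\<^sup>2) \<le> 2 * real N"
        using \<kappa>(2)[where g = g and N = N and L = L] \<kappa>K[OF g] L(2) N by linarith
    qed auto
    also have "\<dots> = real (card G) * (2 * real N * real L)" by simp
    also have "\<dots> \<le> (C * 2 powr (real j / 2)) * (2 * real N * (real N / 2^j))"
      using L(1) by (intro mult_mono card mult_left_mono) (auto intro: order.trans[OF _ card])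
    also have "\<dots> = 2 * C * (2 powr (real j / 2) / 2^j) * (real N)\<^sup>2"
      by (simp add: power2_eq_square)
    also have "2 powr (real j / 2) / 2^j = 2 powr (- real j / 2)"
      by (simp add: powr_realpow[symmetric] powr_diff[symmetric] field_simps)
    also have "2 powr (- real j / 2) = (2 powr (- real j / 4))\<^sup>2"
      by (simp add: power2_eq_square powr_add[symmetric])
    finally have sq: "?S\<^sup>2 \<le> 2 * C * (2 powr (- real j / 4))\<^sup>2 * (real N)\<^sup>2" .
    have "?S \<le> sqrt (2 * C * (2 powr (- real j / 4))\<^sup>2 * (real N)\<^sup>2)"
      using sq by (rule real_le_rsqrt)
    also have "\<dots> = sqrt (2 * C) * 2 powr (- real j / 4) * real N"
      by (simp add: real_sqrt_mult)
    finally show ?thesis .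
  qed
  then show ?thesis by (rule that)
qed

section \<open>The Turan--Kubilius inequality\<close>

lemma sum_multiples_reindex:
  fixes p N :: nat
  assumes "p > 0"
  shows "(\<Sum>n | n \<in> {1..N} \<and> p dvd n. f n) = (\<Sum>m=1..N div p. f (p * m))"
proof (rule sum.reindex_bij_witness[of _ "\<lambda>m. p * m" "\<lambda>n. n div p"])
  fix n assume "n \<in> {n. n \<in> {1..N} \<and> p dvd n}"
  then obtain k where "n = p * k" "1 \<le> p * k" "p * k \<le> N" by auto
  then show "n div p \<in> {1..N div p}" "p * (n div p) = n"
    using assms by (auto simp: less_eq_div_iff_mult_less_eq mult.commute Suc_le_eq)
qed (use assms in \<open>auto simp: less_eq_div_iff_mult_less_eq mult.commute Suc_le_eq\<close>)

lemma sum_of_bool_dvd: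
  fixes p N :: nat
  assumes "p > 0"
  shows "(\<Sum>n=1..N. of_bool (p dvd n)) = real (N div p)"
proof -
  have "(\<Sum>n=1..N. of_bool (p dvd n)) = (\<Sum>n | n \<in> {1..N} \<and> p dvd n. 1 :: real)"
    by (intro sum.mono_neutral_cong_right) auto
  also have "\<dots> = real (N div p)" unfolding sum_multiples_reindex[OF assms] by simp
  finally show ?thesis .
qed

text \<open>
The second moment method: the first two moments of the number of prime divisors in \<open>P\<close> are those of a
sum of independent events of probability \<open>1 / p\<close>, because distinct primes \<open>p\<close> and \<open>q\<close> divide \<open>n\<close>
simultaneously exactly when \<open>p * q\<close> does. The term with \<open>card P\<close> comes from rounding \<open>N / p\<close>.
\<close>

lemma turan_kubilius:
  assumes "finite P" "\<And>p. p \<in> P \<Longrightarrow> prime (p::nat)"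
  defines "A \<equiv> \<Sum>p\<in>P. 1 / real p"
  shows "(\<Sum>n=1..N. ((\<Sum>p\<in>P. of_bool (p dvd n)) - A)\<^sup>2) \<le> A * real N + 2 * A * real (card P)"
proof -
  define \<omega> :: "nat \<Rightarrow> real" where "\<omega> = (\<lambda>n. \<Sum>p\<in>P. of_bool (p dvd n))"
  have pos: "p > 0" if "p \<in> P" for p using assms(2)[OF that] prime_gt_0_nat by blast
  have A0: "A \<ge> 0" by (simp add: A_def sum_nonneg)
  have "(\<Sum>n=1..N. \<omega> n) = (\<Sum>p\<in>P. \<Sum>n=1..N. of_bool (p dvd n))"
    unfolding \<omega>_def by (rule sum.swap)
  also have "\<dots> = (\<Sum>p\<in>P. real (N div p))"
    by (intro sum.cong refl sum_of_bool_dvd pos)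
  also have "\<dots> \<ge> (\<Sum>p\<in>P. real N * (1 / real p) - 1)"
  proof (rule sum_mono)
    fix p assume "p \<in> P"
    have "N < p + p * (N div p)" by (rule dividend_less_times_div[OF pos[OF \<open>p \<in> P\<close>]])
    then have "real N < real (p + p * (N div p))" by (rule of_nat_less_iff[THEN iffD2])
    then have "real N / real p < real (N div p) + 1"
      using pos[OF \<open>p \<in> P\<close>] by (simp add: divide_less_eq algebra_simps)
    then show "real N * (1 / real p) - 1 \<le> real (N div p)" by simp
  qed
  finally have first: "(\<Sum>n=1..N. \<omega> n) \<ge> A * real N - real (card P)"
    unfolding sum_subtractf A_def sum_distrib_left[symmetric] by (simp add: mult.commute)
  have pair: "(\<Sum>n=1..N. of_bool (p dvd n) * of_bool (q dvd n))
      \<le> real N * (1 / real p * (1 / real q)) + (if p = q then real N * (1 / real p) else 0)"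
    if pq: "p \<in> P" "q \<in> P" for p q
  proof (cases "p = q")
    case True
    have "(\<Sum>n=1..N. of_bool (p dvd n) * of_bool (q dvd n)) = (\<Sum>n=1..N. of_bool (p dvd n) :: real)"
      using True by (intro sum.cong) auto
    also have "\<dots> = real (N div p)" by (rule sum_of_bool_dvd[OF pos[OF pq(1)]])
    also have "\<dots> \<le> real N * (1 / real p)" using of_nat_div_le_of_nat[of N p, where 'a = real] by simp
    also have "\<dots> \<le> real N * (1 / real p * (1 / real q)) + real N * (1 / real p)" by simp
    finally show ?thesis using True by simp
  next
    case False
    then have "coprime p q" using assms(2) pq primes_coprime by blast
    then have "(\<Sum>n=1..N. of_bool (p dvd n) * of_bool (q dvd n)) = (\<Sum>n=1..N. of_bool (p * q dvd n) :: real)"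
      by (intro sum.cong refl) (auto intro: divides_mult dvd_mult_left dvd_mult_right)
    also have "\<dots> = real (N div (p * q))"
      using pos[OF pq(1)] pos[OF pq(2)] by (intro sum_of_bool_dvd) simp
    also have "\<dots> \<le> real N * (1 / real p * (1 / real q))"
      using of_nat_div_le_of_nat[of N "p * q", where 'a = real] by simp
    finally show ?thesis using False by simp
  qed
  have "(\<Sum>n=1..N. (\<omega> n)\<^sup>2) = (\<Sum>n=1..N. \<Sum>p\<in>P. \<Sum>q\<in>P. of_bool (p dvd n) * of_bool (q dvd n))"
    unfolding \<omega>_def power2_eq_square sum_product by (rule refl)
  also have "\<dots> = (\<Sum>p\<in>P. \<Sum>n=1..N. \<Sum>q\<in>P. of_bool (p dvd n) * of_bool (q dvd n))" by (rule sum.swap)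
  also have "\<dots> = (\<Sum>p\<in>P. \<Sum>q\<in>P. \<Sum>n=1..N. of_bool (p dvd n) * of_bool (q dvd n))"
    by (intro sum.cong refl sum.swap)
  also have "\<dots> \<le> (\<Sum>p\<in>P. \<Sum>q\<in>P. real N * (1 / real p * (1 / real q)) + (if p = q then real N * (1 / real p) else 0))"
    by (intro sum_mono pair)
  also have "\<dots> = real N * A\<^sup>2 + real N * A"
    unfolding A_def power2_eq_square sum_product using assms(1)
    by (simp add: sum.distrib sum_distrib_left)
  finally have second: "(\<Sum>n=1..N. (\<omega> n)\<^sup>2) \<le> real N * A\<^sup>2 + real N * A" .
  have "(\<Sum>n=1..N. (\<omega> n - A)\<^sup>2) = (\<Sum>n=1..N. (\<omega> n)\<^sup>2) - 2 * A * (\<Sum>n=1..N. \<omega> n) + real N * A\<^sup>2"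
    by (simp add: power2_diff sum.distrib sum_subtractf sum_distrib_left mult_ac)
  also have "\<dots> \<le> (real N * A\<^sup>2 + real N * A) - 2 * A * (A * real N - real (card P)) + real N * A\<^sup>2"
    using second mult_left_mono[OF first, of "2 * A"] A0 by linarith
  also have "\<dots> = A * real N + 2 * A * real (card P)"
    by (simp add: power2_eq_square algebra_simps)
  finally show ?thesis unfolding \<omega>_def .
qed

section \<open>The orthogonality criterion\<close>

text \<open>
The three terms are the pairs with \<open>p dvd m\<close>, where multiplicativity gives no information, the pairs at
which the model set \<open>\<beta> m\<close> is wrong, and the sum over the model sets.
\<close>

lemma dyadic_block_sum_le:
  assumes irr: "\<theta> \<notin> \<rat>" and P: "P \<subseteq> {2^j..<2^(j+1)}"
    and E: "\<And>m p. m > 0 \<Longrightarrow> p \<in> P \<Longrightarrow> \<not> p dvd m \<Longrightarrow> p * m \<in> E \<longleftrightarrow> Q m p"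
    and finG: "finite G" and cardG: "real (card G) \<le> C * 2 powr (real j / 2)"
    and net: "\<And>w. \<exists>g\<in>G. real (card {p\<in>{2^j..<2^(j+1)}. Q w p \<noteq> (p \<in> g)}) \<le> D"
  obtains K :: real where
    "\<And>N. real N \<ge> K \<Longrightarrow> norm (\<Sum>p\<in>P. \<Sum>m=1..N div p. indicator E (p * m) * e (\<theta> * real (p * m)))
       \<le> (1 / 2^j + D / 2^j + sqrt (2 * C) * 2 powr (- real j / 4)) * real N"
proof -
  from net have "\<forall>w. \<exists>g. g \<in> G \<and> real (card {p\<in>{2^j..<2^(j+1)}. Q w p \<noteq> (p \<in> g)}) \<le> D" by blast
  from choice[OF this] obtain \<beta> where \<beta>: "\<And>w. \<beta> w \<in> G"
    "\<And>w. real (card {p\<in>{2^j..<2^(j+1)}. Q w p \<noteq> (p \<in> \<beta> w)}) \<le> D" by auto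
  obtain K where K: "\<And>N. real N \<ge> K \<Longrightarrow>
       norm (\<Sum>p\<in>P. \<Sum>m=1..N div p. if p \<in> \<beta> m then e (\<theta> * real (p * m)) else 0)
       \<le> sqrt (2 * C) * 2 powr (- real j / 4) * real N"
    by (rule net_exponential_sum_le[OF irr P finG \<beta>(1) cardG]) (rule that)
  have finP: "finite P" using P finite_subset by blast
  have Pge: "2 ^ j \<le> p" if "p \<in> P" for p using that P by auto
  have Ppos: "p > 0" if "p \<in> P" for p using that P by (auto intro!: Nat.gr0I)
  have "card P \<le> card {2^j..<(2::nat)^(j+1)}" using P by (intro card_mono) auto
  then have cardP: "real (card P) \<le> 2^j" using of_nat_mono[of "card P" "2^j", where 'a = real] by simp
  have "norm (\<Sum>p\<in>P. \<Sum>m=1..N div p. indicator E (p * m) * e (\<theta> * real (p * m)))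
       \<le> (1 / 2^j + D / 2^j + sqrt (2 * C) * 2 powr (- real j / 4)) * real N"
    if N: "real N \<ge> K" for N
  proof -
    define L where "L = N div 2^j"
    have L: "real L \<le> real N / 2^j"
      using of_nat_div_le_of_nat[of N "2^j", where 'a = real] by (simp add: L_def)
    define a where "a = (\<lambda>p m. indicator E (p * m) * e (\<theta> * real (p * m)))"
    define b where "b = (\<lambda>p m. if p \<in> \<beta> m then e (\<theta> * real (p * m)) else 0)"
    have "norm (a p m - b p m) \<le> of_bool (p dvd m) + of_bool (Q m p \<noteq> (p \<in> \<beta> m))"
      if "p \<in> P" "m \<in> {1..N div p}" for p m
      using E[of m p] that by (auto simp: a_def b_def indicator_def of_bool_def)
    then have "norm (\<Sum>p\<in>P. \<Sum>m=1..N div p. a p m - b p m)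
        \<le> (\<Sum>p\<in>P. \<Sum>m=1..N div p. of_bool (p dvd m) + of_bool (Q m p \<noteq> (p \<in> \<beta> m)))"
      by (intro sum_norm_le)
    also have "\<dots> = (\<Sum>p\<in>P. \<Sum>m=1..N div p. of_bool (p dvd m))
        + (\<Sum>p\<in>P. \<Sum>m=1..N div p. of_bool (Q m p \<noteq> (p \<in> \<beta> m)))"
      by (simp only: sum.distrib)
    finally have split: "norm (\<Sum>p\<in>P. \<Sum>m=1..N div p. a p m - b p m) \<le> \<dots>" .
    have "(\<Sum>p\<in>P. \<Sum>m=1..N div p. of_bool (p dvd m)) \<le> (\<Sum>p\<in>P. real N / 2^j / 2^j)"
    proof (rule sum_mono)
      fix p assume p: "p \<in> P"
      have p2: "2 ^ j \<le> real p" using Pge[OF p] by (metis of_nat_le_iff of_nat_numeral of_nat_power)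
      have "(\<Sum>m=1..N div p. of_bool (p dvd m)) = real (N div p div p)"
        by (rule sum_of_bool_dvd[OF Ppos[OF p]])
      also have "\<dots> \<le> real N / real p / real p"
        by (rule order.trans[OF of_nat_div_le_of_nat divide_right_mono[OF of_nat_div_le_of_nat]]) simp
      also have "\<dots> \<le> real N / 2^j / 2^j"
        using p2 Ppos[OF p] by (intro frac_le divide_nonneg_nonneg) auto
      finally show "(\<Sum>m=1..N div p. of_bool (p dvd m)) \<le> real N / 2^j / 2^j" .
    qed
    also have "(\<Sum>p\<in>P. real N / 2^j / 2^j) \<le> 2^j * (real N / 2^j / 2^j)"
      using mult_right_mono[OF cardP, of "real N / 2^j / 2^j"] by simp
    also have "\<dots> = 1 / 2^j * real N" by simp
    finally have divisors: "(\<Sum>p\<in>P. \<Sum>m=1..N div p. of_bool (p dvd m)) \<le> 1 / 2^j * real N" .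
    have "(\<Sum>p\<in>P. \<Sum>m=1..N div p. of_bool (Q m p \<noteq> (p \<in> \<beta> m)))
        \<le> (\<Sum>p\<in>P. \<Sum>m=1..L. of_bool (Q m p \<noteq> (p \<in> \<beta> m)) :: real)"
    proof (intro sum_mono sum_mono2)
      fix p assume "p \<in> P"
      then have "N div p \<le> L" unfolding L_def by (intro div_le_mono2 Pge) auto
      then show "{1..N div p} \<subseteq> {1..L}" by auto
    qed auto
    also have "\<dots> = (\<Sum>m=1..L. \<Sum>p\<in>P. of_bool (Q m p \<noteq> (p \<in> \<beta> m)))" by (rule sum.swap)
    also have "\<dots> \<le> (\<Sum>m=1..L. D)"
    proof (rule sum_mono)
      fix m
      have "(\<Sum>p\<in>P. of_bool (Q m p \<noteq> (p \<in> \<beta> m))) = real (card {p\<in>P. Q m p \<noteq> (p \<in> \<beta> m)})"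
        using finP by (simp add: Int_def)
      also have "\<dots> \<le> real (card {p\<in>{2^j..<2^(j+1)}. Q m p \<noteq> (p \<in> \<beta> m)})"
        using P by (intro of_nat_mono card_mono) auto
      also have "\<dots> \<le> D" by (rule \<beta>(2))
      finally show "(\<Sum>p\<in>P. of_bool (Q m p \<noteq> (p \<in> \<beta> m))) \<le> D" .
    qed
    also have "\<dots> = real L * D" by simp
    also have "\<dots> \<le> real N / 2^j * D"
      using L \<beta>(2)[of 0] by (intro mult_right_mono) (auto intro: order.trans[rotated])
    also have "\<dots> = D / 2^j * real N" by simp
    finally have "norm (\<Sum>p\<in>P. \<Sum>m=1..N div p. a p m - b p m) \<le> (1 / 2^j + D / 2^j) * real N"
      using split divisors unfolding distrib_right by linarith
    moreover have "norm (\<Sum>p\<in>P. \<Sum>m=1..N div p. b p m) \<le> sqrt (2 * C) * 2 powr (- real j / 4) * real N"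
      unfolding b_def by (rule K[OF N])
    moreover have "(\<Sum>p\<in>P. \<Sum>m=1..N div p. a p m)
        = (\<Sum>p\<in>P. \<Sum>m=1..N div p. a p m - b p m) + (\<Sum>p\<in>P. \<Sum>m=1..N div p. b p m)"
      by (simp add: sum_subtractf)
    ultimately have "norm (\<Sum>p\<in>P. \<Sum>m=1..N div p. a p m)
       \<le> (1 / 2^j + D / 2^j) * real N + sqrt (2 * C) * 2 powr (- real j / 4) * real N"
      by (smt (verit) norm_triangle_ineq)
    then show ?thesis unfolding a_def by (simp add: algebra_simps)
  qed
  then show ?thesis by (rule that)
qed

lemma sum_dyadic_blocks:
  fixes f :: "nat \<Rightarrow> 'a :: comm_monoid_add"
  assumes "0 \<notin> \<P>"
  shows "(\<Sum>p\<in>\<P> \<inter> {..<2^J}. f p) = (\<Sum>j<J. \<Sum>p\<in>\<P> \<inter> {2^j..<2^(j+1)}. f p)"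
proof (induction J)
  case 0
  have "\<P> \<inter> {..<2^0} = {}" using assms by auto
  then show ?case by simp
next
  case (Suc J)
  have split: "\<P> \<inter> {..<2^Suc J} = (\<P> \<inter> {..<2^J}) \<union> (\<P> \<inter> {2^J..<2^(J+1)})"
    by (auto simp: not_less)
  have "(\<Sum>p\<in>\<P> \<inter> {..<2^Suc J}. f p)
      = (\<Sum>p\<in>\<P> \<inter> {..<2^J}. f p) + (\<Sum>p\<in>\<P> \<inter> {2^J..<2^(J+1)}. f p)"
    unfolding split by (rule sum.union_disjoint) auto
  then show ?case using Suc.IH by simp
qed

lemma unbounded_partial_sums:
  assumes "\<not> (\<lambda>p. 1 / real p) summable_on \<P>"
  obtains J where "(\<Sum>p\<in>\<P> \<inter> {..<2^J}. 1 / real p) > A"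
proof -
  have "\<exists>F. finite F \<and> F \<subseteq> \<P> \<and> (\<Sum>p\<in>F. 1 / real p) > A"
  proof (rule ccontr)
    assume "\<not> ?thesis"
    then have bdd: "(\<Sum>p\<in>F. 1 / real p) \<le> A" if "finite F" "F \<subseteq> \<P>" for F
      using that by (meson not_less)
    have "(\<lambda>p. 1 / real p) summable_on \<P>"
    proof (rule nonneg_bounded_partial_sums_imp_summable_on)
      show "eventually (\<lambda>X. sum (\<lambda>p. 1 / real p) X \<le> A) (finite_subsets_at_top \<P>)"
        by (rule eventually_finite_subsets_at_top_weakI) (rule bdd)
    qed simp
    then show False using assms by blast
  qed
  then obtain F where F: "finite F" "F \<subseteq> \<P>" "(\<Sum>p\<in>F. 1 / real p) > A" by blast
  obtain J where J: "\<forall>p\<in>F. p < J" using F(1) finite_nat_set_iff_bounded by blast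
  have "p < 2 ^ J" if "p \<in> F" for p
    using J that less_exp[of J] by (meson less_trans)
  then have "F \<subseteq> \<P> \<inter> {..<2^J}" using F(2) by auto
  then have "(\<Sum>p\<in>F. 1 / real p) \<le> (\<Sum>p\<in>\<P> \<inter> {..<2^J}. 1 / real p)"
    by (intro sum_mono2) auto
  then show ?thesis using F(3) by (intro that[of J]) linarith
qed

text \<open>
The bounds for the blocks form a convergent series with sum \<open>B\<close>, so the bilinear sum over all primes
below \<open>2^J\<close> is at most \<open>B * N\<close>, however large \<open>J\<close> is. Since the sum \<open>A\<close> of the \<open>1 / p\<close> over these primes tends to infinity with \<open>J\<close>, the
quotient \<open>(B + sqrt (2 * A)) / A\<close> becomes smaller than \<open>\<eta>\<close>.
\<close>

theorem exponential_sum_criterion: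
  fixes \<P> :: "nat set" and E :: "nat set"
  assumes irr: "\<theta> \<notin> \<rat>"
    and primes: "\<And>p. p \<in> \<P> \<Longrightarrow> prime p"
    and diverges: "\<not> (\<lambda>p. 1 / real p) summable_on \<P>"
    and entropy: "low_entropy Q"
    and E: "\<And>m p. m > 0 \<Longrightarrow> p \<in> \<P> \<Longrightarrow> \<not> p dvd m \<Longrightarrow> p * m \<in> E \<longleftrightarrow> Q m p"
    and \<eta>: "\<eta> > 0"
  shows "eventually (\<lambda>N. norm (\<Sum>n=1..N. indicator E n * e (\<theta> * real n)) \<le> \<eta> * real N) sequentially"
proof -
  have half: "(0::real) < 1 / 2" "(1::real) / 2 < 1" by auto
  obtain \<delta> C G where \<delta>: "\<delta> > 0" and C: "C \<ge> 0" and finG: "\<And>j::nat. finite (G j)"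
    and cardG: "\<And>j. real (card (G j)) \<le> C * 2 powr (1 / 2 * real j)"
    and net: "\<And>j w. \<exists>g\<in>G j. real (card {p\<in>{2^j..<2^(j+1)}. Q w p \<noteq> (p \<in> g)}) \<le> C * 2 powr ((1 - \<delta>) * real j)"
    by (rule low_entropyE[OF entropy half]) blast
  define b where "b = (\<lambda>j::nat. 1 / 2^j + C * 2 powr ((1 - \<delta>) * real j) / 2^j + sqrt (2 * C) * 2 powr (- real j / 4))"
  have b_geometric: "b = (\<lambda>j. (1 / 2) ^ j + C * (2 powr (- \<delta>)) ^ j + sqrt (2 * C) * (2 powr (- 1 / 4)) ^ j)"
  proof
    fix j :: nat
    have "2 powr ((1 - \<delta>) * real j) / 2 ^ j = 2 powr ((1 - \<delta>) * real j - real j)"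
      by (simp add: powr_diff powr_realpow)
    also have "\<dots> = (2 powr (- \<delta>)) ^ j" by (simp add: powr_power algebra_simps)
    finally have "2 powr ((1 - \<delta>) * real j) / 2 ^ j = (2 powr (- \<delta>)) ^ j" .
    moreover have "2 powr (- real j / 4) = (2 powr (- 1 / 4)) ^ j" by (simp add: powr_power)
    ultimately show "b j = (1 / 2) ^ j + C * (2 powr (- \<delta>)) ^ j + sqrt (2 * C) * (2 powr (- 1 / 4)) ^ j"
      by (simp add: b_def power_one_over times_divide_eq_right[symmetric] del: times_divide_eq_right)
  qed
  have "2 powr (- \<delta>) < 1" by (intro powr_less_one) (use \<delta> in auto)
  moreover have "2 powr (- 1 / 4) < (1::real)" by (intro powr_less_one) auto
  ultimately have "summable b"
    unfolding b_geometric by (intro summable_add summable_mult summable_geometric) auto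
  have b_nonneg: "b j \<ge> 0" for j unfolding b_geometric using C by simp
  define B where "B = suminf b"
  have B: "(\<Sum>j<J. b j) \<le> B" for J
    unfolding B_def using \<open>summable b\<close> b_nonneg by (intro sum_le_suminf) auto
  have B0: "B \<ge> 0" using B[of 0] by simp

\<comment> \<open>The two lower bounds for this sum, called \<open>A\<close> below, yield \<open>B \<le> A * \<eta> / 2\<close> and \<open>sqrt (2 * A) \<le> A * \<eta> / 2\<close>.\<close>
  obtain J where J: "(\<Sum>p\<in>\<P> \<inter> {..<2^J}. 1 / real p) > max (2 * B / \<eta>) (8 / \<eta>\<^sup>2)"
    by (rule unbounded_partial_sums[OF diverges])
  define P where "P = \<P> \<inter> {..<2^J}"
  define A where "A = (\<Sum>p\<in>P. 1 / real p)"
  have A: "A > 2 * B / \<eta>" "A > 8 / \<eta>\<^sup>2" using J by (auto simp: A_def P_def)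
  have "8 / \<eta>\<^sup>2 > 0" using \<eta> by simp
  then have A_pos: "A > 0" using A(2) by linarith
  have finP: "finite P" by (simp add: P_def)
  have pos: "p > 0" if "p \<in> \<P>" for p using primes[OF that] prime_gt_0_nat by blast
  have "\<exists>K. \<forall>N. real N \<ge> K \<longrightarrow>
      norm (\<Sum>p\<in>\<P> \<inter> {2^j..<2^(j+1)}. \<Sum>m=1..N div p. indicator E (p * m) * e (\<theta> * real (p * m)))
       \<le> b j * real N" for j
  proof (rule dyadic_block_sum_le[OF irr _ _ finG _ net])
    show "real (card (G j)) \<le> C * 2 powr (real j / 2)" using cardG[of j] by simp
    show "(p * m \<in> E) = Q m p" if "m > 0" "p \<in> \<P> \<inter> {2^j..<2^(j+1)}" "\<not> p dvd m" for m p
      using E that by blast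
  qed (auto simp: b_def)
  then have "\<forall>j. \<exists>K. \<forall>N. real N \<ge> K \<longrightarrow>
      norm (\<Sum>p\<in>\<P> \<inter> {2^j..<2^(j+1)}. \<Sum>m=1..N div p. indicator E (p * m) * e (\<theta> * real (p * m)))
       \<le> b j * real N"
    by (rule allI)
  from choice[OF this] obtain K where "\<forall>j N. real N \<ge> K j \<longrightarrow>
      norm (\<Sum>p\<in>\<P> \<inter> {2^j..<2^(j+1)}. \<Sum>m=1..N div p. indicator E (p * m) * e (\<theta> * real (p * m)))
       \<le> b j * real N"
    by (rule exE)
  note K = this[rule_format]
\<comment> \<open>Beyond \<open>K0\<close> all block estimates hold and the rounding term of Turan--Kubilius is absorbed.\<close>
  define K0 where "K0 = (\<Sum>j<J. \<bar>K j\<bar>) + 2 * real (card P)"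
  have K0: "K j \<le> K0" if "j < J" for j
  proof -
    have "K j \<le> \<bar>K j\<bar>" by simp
    also have "\<dots> \<le> (\<Sum>j<J. \<bar>K j\<bar>)" by (rule member_le_sum) (use that in auto)
    finally show ?thesis by (simp add: K0_def)
  qed
  have "norm (\<Sum>n=1..N. indicator E n * e (\<theta> * real n)) \<le> \<eta> * real N" if N: "real N \<ge> K0" for N
  proof -
    define a where "a = (\<lambda>n. indicator E n * e (\<theta> * real n))"
    define \<omega> :: "nat \<Rightarrow> real" where "\<omega> = (\<lambda>n. \<Sum>p\<in>P. of_bool (p dvd n))"
    have norm_a: "norm (a n) \<le> 1" for n by (simp add: a_def norm_mult indicator_def)
    have "(\<Sum>n=1..N. of_real (\<omega> n) * a n) = (\<Sum>n=1..N. \<Sum>p\<in>P. of_bool (p dvd n) * a n)"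
      by (auto simp: \<omega>_def sum_distrib_right of_bool_def intro!: sum.cong)
    also have "\<dots> = (\<Sum>p\<in>P. \<Sum>n=1..N. of_bool (p dvd n) * a n)" by (rule sum.swap)
    also have "\<dots> = (\<Sum>p\<in>P. \<Sum>m=1..N div p. a (p * m))"
    proof (rule sum.cong[OF refl])
      fix p assume "p \<in> P"
      then have "p > 0" using pos by (simp add: P_def)
      have "(\<Sum>n=1..N. of_bool (p dvd n) * a n) = (\<Sum>n | n \<in> {1..N} \<and> p dvd n. a n)"
        by (intro sum.mono_neutral_cong_right) auto
      also have "\<dots> = (\<Sum>m=1..N div p. a (p * m))" by (rule sum_multiples_reindex[OF \<open>p > 0\<close>])
      finally show "(\<Sum>n=1..N. of_bool (p dvd n) * a n) = (\<Sum>m=1..N div p. a (p * m))" .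
    qed
    also have "\<dots> = (\<Sum>j<J. \<Sum>p\<in>\<P> \<inter> {2^j..<2^(j+1)}. \<Sum>m=1..N div p. a (p * m))"
      unfolding P_def by (rule sum_dyadic_blocks) (use pos in auto)
    finally have "norm (\<Sum>n=1..N. of_real (\<omega> n) * a n)
        = norm (\<Sum>j<J. \<Sum>p\<in>\<P> \<inter> {2^j..<2^(j+1)}. \<Sum>m=1..N div p. a (p * m))"
      by (rule arg_cong)
    also have "\<dots> \<le> (\<Sum>j<J. b j * real N)"
    proof (rule sum_norm_le)
      fix j assume "j \<in> {..<J}"
      then have "real N \<ge> K j" using K0[of j] N by simp
      then show "norm (\<Sum>p\<in>\<P> \<inter> {2^j..<2^(j+1)}. \<Sum>m=1..N div p. a (p * m)) \<le> b j * real N"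
        unfolding a_def by (rule K)
    qed
    also have "\<dots> \<le> B * real N"
      unfolding sum_distrib_right[symmetric] by (intro mult_right_mono B) simp
    finally have main: "norm (\<Sum>n=1..N. of_real (\<omega> n) * a n) \<le> B * real N" .

    have "norm (\<Sum>n=1..N. of_real (A - \<omega> n) * a n) \<le> (\<Sum>n=1..N. \<bar>A - \<omega> n\<bar>)"
    proof (rule sum_norm_le)
      fix n
      have "norm (of_real (A - \<omega> n) * a n) = \<bar>A - \<omega> n\<bar> * norm (a n)"
        by (simp only: norm_mult norm_of_real)
      then show "norm (of_real (A - \<omega> n) * a n) \<le> \<bar>A - \<omega> n\<bar>"
        using mult_left_le[OF norm_a[of n], of "\<bar>A - \<omega> n\<bar>"] by simp
    qed
    also have "\<dots> \<le> sqrt (2 * A) * real N"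
    proof -
      have "(\<Sum>n=1..N. \<bar>A - \<omega> n\<bar>)\<^sup>2 \<le> (\<Sum>n=1..N. (\<omega> n - A)\<^sup>2) * real N"
        using sum_squared_le_sum_of_squares[of "\<lambda>n. \<bar>A - \<omega> n\<bar>" "{1..N}"]
        by (simp add: power2_commute)
      also have "\<dots> \<le> (A * real N + 2 * A * real (card P)) * real N"
        unfolding \<omega>_def A_def
        by (intro mult_right_mono turan_kubilius finP) (use primes in \<open>auto simp: P_def\<close>)
      also have "\<dots> \<le> (A * real N + A * real N) * real N"
      proof -
        have "2 * real (card P) \<le> real N" using N by (simp add: K0_def) (smt (verit) sum_nonneg abs_ge_zero)
        then have "A * (2 * real (card P)) \<le> A * real N" using A_pos by (intro mult_left_mono) auto
        then show ?thesis by (intro mult_right_mono) auto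
      qed
      also have "\<dots> = 2 * A * (real N)\<^sup>2" by (simp add: power2_eq_square)
      finally have "(\<Sum>n=1..N. \<bar>A - \<omega> n\<bar>) \<le> sqrt (2 * A * (real N)\<^sup>2)" by (rule real_le_rsqrt)
      then show ?thesis by (simp add: real_sqrt_mult)
    qed
    finally have fluctuation: "norm (\<Sum>n=1..N. of_real (A - \<omega> n) * a n) \<le> sqrt (2 * A) * real N" .

    have "of_real A * (\<Sum>n=1..N. a n) = (\<Sum>n=1..N. of_real (A - \<omega> n) * a n) + (\<Sum>n=1..N. of_real (\<omega> n) * a n)"
      by (simp add: sum_distrib_left sum.distrib[symmetric] algebra_simps)
    then have "norm (of_real A * (\<Sum>n=1..N. a n)) \<le> sqrt (2 * A) * real N + B * real N"
      using main fluctuation by (smt (verit) norm_triangle_ineq)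
    then have "A * norm (\<Sum>n=1..N. a n) \<le> (sqrt (2 * A) + B) * real N"
      using A_pos by (simp add: norm_mult algebra_simps)
    also have "\<dots> \<le> A * \<eta> * real N"
    proof (rule mult_right_mono)
      have "2 * A \<le> (A * \<eta> / 2)\<^sup>2"
      proof -
        have "8 \<le> A * \<eta>\<^sup>2" using A(2) \<eta> by (simp add: field_simps)
        then have "A * 8 \<le> A * (A * \<eta>\<^sup>2)" using A_pos by (intro mult_left_mono) auto
        then show ?thesis by (simp add: power2_eq_square field_simps)
      qed
      then have "sqrt (2 * A) \<le> A * \<eta> / 2" using A_pos \<eta> by (intro real_le_lsqrt) auto
      moreover have "B \<le> A * \<eta> / 2" using A(1) \<eta> by (simp add: field_simps)
      ultimately show "sqrt (2 * A) + B \<le> A * \<eta>" by linarith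
    qed simp
    finally have "A * norm (\<Sum>n=1..N. a n) \<le> A * (\<eta> * real N)" by (simp only: mult.assoc)
    then show ?thesis using A_pos unfolding a_def by simp
  qed
  then show ?thesis
    using eventually_ge_at_top[of "nat \<lceil>K0\<rceil>"] by (auto elim!: eventually_mono simp: nat_ceiling_le_eq)
qed

lemma exponential_sum_smalloI:
  fixes E :: "nat set" and \<theta> :: real
  assumes "\<And>\<eta>. \<eta> > 0 \<Longrightarrow>
    eventually (\<lambda>N. norm (\<Sum>n=1..N. indicator E n * e (\<theta> * real n)) \<le> \<eta> * real N) sequentially"
  shows "(\<lambda>x::real. \<Sum>n | n > 0 \<and> real n \<le> x. indicator E n * e (\<theta> * real n))
           \<in> o[at_top](\<lambda>x. complex_of_real x)"
proof (rule landau_o.smallI)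
  fix c :: real assume "c > 0"
  from assms[OF this] obtain N0 where
    N0: "\<And>N. N \<ge> N0 \<Longrightarrow> norm (\<Sum>n=1..N. indicator E n * e (\<theta> * real n)) \<le> c * real N"
    unfolding eventually_sequentially by blast
  show "eventually (\<lambda>x. norm (\<Sum>n | n > 0 \<and> real n \<le> x. indicator E n * e (\<theta> * real n))
      \<le> c * norm (complex_of_real x)) at_top"
    using eventually_ge_at_top[of "real N0"]
  proof eventually_elim
    case (elim x)
    define N where "N = nat \<lfloor>x\<rfloor>"
    have "x \<ge> 0" using elim by linarith
    have "{n. n > 0 \<and> real n \<le> x} = {1..N}"
      using \<open>x \<ge> 0\<close> by (auto simp: N_def le_nat_floor Suc_le_eq) linarith
    moreover have "N \<ge> N0" using elim by (simp add: N_def le_nat_floor)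
    ultimately have "norm (\<Sum>n | n > 0 \<and> real n \<le> x. indicator E n * e (\<theta> * real n)) \<le> c * real N"
      using N0 by simp
    also have "\<dots> \<le> c * x" using \<open>c > 0\<close> \<open>x \<ge> 0\<close> by (intro mult_left_mono) (auto simp: N_def)
    finally show ?case using \<open>x \<ge> 0\<close> by simp
  qed
qed

section \<open>Divergence of the sum of the reciprocals of the primes\<close>

text \<open>
Write \<open>n\<close> as a squarefree number times a square. The squarefree part is determined by the subset of
\<open>F\<close> of the primes with odd multiplicity in \<open>n\<close>, and the root of the square part is at most \<open>M\<close>.
\<close>

lemma card_smooth_numbers_le:
  fixes F :: "nat set"
  assumes "finite F" "finite S"
    and S: "\<And>n. n \<in> S \<Longrightarrow> 0 < n \<and> n \<le> M\<^sup>2 \<and> (\<forall>p. prime p \<longrightarrow> p dvd n \<longrightarrow> p \<in> F)"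
  shows "card S \<le> 2 ^ card F * M"
proof -
  define code where "code = (\<lambda>n. ({p\<in>F. odd (multiplicity p n)}, square_part n))"
  have "inj_on code S"
  proof (rule inj_onI)
    fix m n assume mn: "m \<in> S" "n \<in> S" "code m = code n"
    show "m = n"
    proof (rule multiplicity_eq_nat)
      fix p :: nat assume p: "prime p"
      show "multiplicity p m = multiplicity p n"
      proof (cases "p \<in> F")
        case True
        have "multiplicity p m div 2 = multiplicity p n div 2"
          using mn(3) prime_multiplicity_square_part[OF p, of m] prime_multiplicity_square_part[OF p, of n]
          by (simp add: code_def)
        moreover have "odd (multiplicity p m) \<longleftrightarrow> odd (multiplicity p n)"
          using mn(3) True by (auto simp: code_def)
        ultimately show ?thesis by (metis even_two_times_div_two odd_two_times_div_two_succ)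
      next
        case False
        then have "\<not> p dvd m" "\<not> p dvd n" using S mn p by blast+
        then show ?thesis by (simp add: not_dvd_imp_multiplicity_0)
      qed
    qed (use S mn in auto)
  qed
  moreover have "code ` S \<subseteq> Pow F \<times> {1..M}"
  proof
    fix c assume "c \<in> code ` S"
    then obtain n where n: "n \<in> S" "c = code n" by blast
    have "(square_part n)\<^sup>2 \<le> n" using S[OF n(1)] by (intro dvd_imp_le) auto
    then have "(square_part n)\<^sup>2 \<le> M\<^sup>2" using S[OF n(1)] by linarith
    then have "square_part n \<le> M" by (rule power2_le_imp_le) simp
    moreover have "square_part n > 0" using S[OF n(1)] by (intro Nat.gr0I) auto
    ultimately show "c \<in> Pow F \<times> {1..M}" by (auto simp: n(2) code_def Suc_le_eq)
  qed
  ultimately have "card S \<le> card (Pow F \<times> {1..M})"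
    using assms(1) by (intro card_inj_on_le[of code]) auto
  then show ?thesis using assms(1) by (simp add: card_cartesian_product card_Pow)
qed

text \<open>
Erdos' argument. If the series converged, then some finite set \<open>F\<close> of primes would leave a remainder
below \<open>1 / 2\<close>, so fewer than half of the integers up to \<open>N\<close> would have a prime factor outside \<open>F\<close>.
But at most \<open>2 ^ card F * sqrt N\<close> integers up to \<open>N\<close> have all prime factors in \<open>F\<close>, and this is only \<open>N / 2\<close>
for \<open>N = 4 ^ (card F + 1)\<close>.
\<close>

lemma primes_reciprocal_not_summable: "\<not> (\<lambda>p. 1 / real p) summable_on {p::nat. prime p}"
proof
  let ?f = "\<lambda>p::nat. 1 / real p" and ?A = "{p::nat. prime p}"
  assume summable: "?f summable_on ?A"
  define S where "S = infsum ?f ?A"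
  have "(?f has_sum S) ?A" using summable by (simp add: S_def)
  then have "eventually (\<lambda>F. S - 1 / 2 < sum ?f F) (finite_subsets_at_top ?A)"
    unfolding has_sum_def by (rule order_tendstoD(1)) simp
  then obtain F where F: "finite F" "F \<subseteq> ?A" "S - 1 / 2 < sum ?f F"
    unfolding eventually_finite_subsets_at_top by blast
  have tail: "sum ?f T < 1 / 2" if T: "finite T" "T \<subseteq> ?A - F" for T
  proof -
    have "sum ?f (F \<union> T) \<le> S"
      unfolding S_def by (rule finite_sum_le_infsum[OF summable]) (use F T in auto)
    moreover have "sum ?f (F \<union> T) = sum ?f F + sum ?f T"
      using F T by (intro sum.union_disjoint) auto
    ultimately show ?thesis using F(3) by linarith
  qed
  define M N :: nat where "M = 2 ^ (card F + 1)" and "N = M\<^sup>2"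
  define T where "T = {p\<in>?A - F. p \<le> N}"
  define smooth where "smooth = {n\<in>{1..N}. \<forall>p. prime p \<longrightarrow> p dvd n \<longrightarrow> p \<in> F}"
  have le: "p \<le> N" if "n \<in> {1..N}" "p dvd n" for n p
    using that dvd_imp_le[of p n] by auto
  have "{1..N} \<subseteq> smooth \<union> (\<Union>p\<in>T. {n\<in>{1..N}. p dvd n})"
    using le unfolding smooth_def T_def by blast
  then have "card {1..N} \<le> card (smooth \<union> (\<Union>p\<in>T. {n\<in>{1..N}. p dvd n}))"
    by (intro card_mono) (auto simp: smooth_def T_def)
  also have "\<dots> \<le> card smooth + card (\<Union>p\<in>T. {n\<in>{1..N}. p dvd n})" by (rule card_Un_le)
  also have "\<dots> \<le> card smooth + (\<Sum>p\<in>T. card {n\<in>{1..N}. p dvd n})"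
    by (intro add_left_mono card_UN_le) (simp add: T_def)
  finally have split: "real N \<le> real (card smooth) + (\<Sum>p\<in>T. real (card {n\<in>{1..N}. p dvd n}))"
    by (simp flip: of_nat_sum of_nat_add)
  have "(\<Sum>p\<in>T. real (card {n\<in>{1..N}. p dvd n})) \<le> (\<Sum>p\<in>T. real N * ?f p)"
  proof (rule sum_mono)
    fix p assume "p \<in> T"
    then have p: "p > 0" using prime_gt_0_nat by (auto simp: T_def)
    have "{n\<in>{1..N}. p dvd n} \<subseteq> (\<lambda>k. p * k) ` {1..N div p}"
    proof
      fix n assume "n \<in> {n\<in>{1..N}. p dvd n}"
      then obtain k where "n = p * k" "p * k \<ge> 1" "p * k \<le> N" by auto
      then show "n \<in> (\<lambda>k. p * k) ` {1..N div p}"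
        using p by (auto simp: less_eq_div_iff_mult_less_eq mult.commute Suc_le_eq)
    qed
    then have "card {n\<in>{1..N}. p dvd n} \<le> card {1..N div p}"
      by (meson card_image_le card_mono finite_atLeastAtMost finite_imageI order_trans)
    then have "real (card {n\<in>{1..N}. p dvd n}) \<le> real (N div p)" by simp
    also have "\<dots> \<le> real N * ?f p" using of_nat_div_le_of_nat[of N p, where 'a = real] by simp
    finally show "real (card {n\<in>{1..N}. p dvd n}) \<le> real N * ?f p" .
  qed
  also have "\<dots> = real N * sum ?f T" by (simp only: sum_distrib_left)
  also have "\<dots> < real N * (1 / 2)"
    by (intro mult_strict_left_mono tail) (auto simp: T_def N_def M_def)
  finally have rough: "(\<Sum>p\<in>T. real (card {n\<in>{1..N}. p dvd n})) < real N * (1 / 2)" .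
  have "card smooth \<le> 2 ^ card F * M"
    by (rule card_smooth_numbers_le[OF F(1)]) (auto simp: smooth_def N_def)
  then have "real (card smooth) \<le> real (2 ^ card F * M)" by (rule of_nat_mono)
  also have "\<dots> = real N / 2" by (simp add: N_def M_def power2_eq_square)
  finally show False using split rough by linarith
qed

section \<open>Polar rectangles\<close>

lemma e_eq_iff: "e x = e y \<longleftrightarrow> (\<exists>n::int. x = y + of_int n)"
proof -
  have "e x = e y \<longleftrightarrow> e (x - y) = 1"
    using e_add[of "x - y" y] norm_e[of y] by (auto simp del: norm_e)
  also have "\<dots> \<longleftrightarrow> (\<exists>n::int. x = y + of_int n)"
    unfolding e_eq_1_iff by (auto simp: Ints_def algebra_simps)
  finally show ?thesis .
qed

lemma e_half: "e (x + 1 / 2) = - e x"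
  using cis_pi by (simp add: e_add) (simp add: e_def cis_conv_exp mult_ac)

lemma is_interval_affine_vimage:
  fixes I :: "real set"
  assumes "is_interval I"
  shows "is_interval {x. c * x + d \<in> I}"
  unfolding is_interval_1
proof (intro ballI allI impI)
  fix a b x assume ab: "a \<in> {x. c * x + d \<in> I}" "b \<in> {x. c * x + d \<in> I}" "a \<le> x \<and> x \<le> b"
  show "x \<in> {x. c * x + d \<in> I}"
  proof (cases "c \<ge> 0")
    case True
    then have "c * a + d \<le> c * x + d" "c * x + d \<le> c * b + d"
      using ab(3) by (auto intro: mult_left_mono)
    then show ?thesis using ab(1,2) mem_is_interval_1_I[OF assms] by blast
  next
    case False
    then have "c * b + d \<le> c * x + d" "c * x + d \<le> c * a + d"
      using ab(3) by (auto intro: mult_left_mono_neg)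
    then show ?thesis using ab(1,2) mem_is_interval_1_I[OF assms] by blast
  qed
qed

lemma interval_translate_near:
  fixes I :: "real set"
  assumes "is_interval I" "a \<in> I" "x + of_int n \<in> I"
  obtains n' :: int where "x + of_int n' \<in> I" "\<bar>x + of_int n' - a\<bar> < 1"
proof (cases "x + of_int n \<ge> a")
  case True
  define n' where "n' = n - \<lfloor>x + of_int n - a\<rfloor>"
  have "a \<le> x + of_int n'" "x + of_int n' < a + 1" unfolding n'_def by linarith+
  moreover have "\<lfloor>x + of_int n - a\<rfloor> \<ge> 0" using True by simp
  then have "x + of_int n' \<le> x + of_int n" by (simp add: n'_def)
  ultimately show ?thesis using mem_is_interval_1_I[OF assms(1,2,3)] by (intro that[of n']) auto
next
  case False
  define n' where "n' = n + \<lfloor>a - x - of_int n\<rfloor>"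
  have "x + of_int n' \<le> a" "a - 1 < x + of_int n'" unfolding n'_def by linarith+
  moreover have "\<lfloor>a - x - of_int n\<rfloor> \<ge> 0" using False by linarith
  then have "x + of_int n \<le> x + of_int n'" by (simp add: n'_def)
  ultimately show ?thesis using mem_is_interval_1_I[OF assms(1,3,2)] by (intro that[of n']) auto
qed

text \<open>
An interval that meets the coset of \<open>x\<close> modulo the integers meets it at distance less than \<open>1\<close> from any
prescribed point of the interval, so finitely many translates suffice for all \<open>x\<close> in a bounded range.
This turns the angular condition of a polar rectangle into finitely many interval conditions.
The range \<open>{0..<3}\<close> has room for the sum of two turns in \<open>{0..<1}\<close> and a possible half turn.
\<close>

lemma interval_translates_finite:
  fixes I :: "real set"
  assumes "is_interval I"
  obtains S :: "int set" where "finite S"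
    "\<And>x. 0 \<le> x \<Longrightarrow> x < 3 \<Longrightarrow> (\<exists>n. x + of_int n \<in> I) \<longleftrightarrow> (\<exists>n\<in>S. x + of_int n \<in> I)"
proof (cases "I = {}")
  case True
  then show ?thesis using that[of "{}"] by simp
next
  case False
  then obtain a where a: "a \<in> I" by blast
  have "(\<exists>n. x + of_int n \<in> I) \<longleftrightarrow> (\<exists>n\<in>{\<lfloor>a\<rfloor> - 4..\<lfloor>a\<rfloor> + 2}. x + of_int n \<in> I)"
    if x: "0 \<le> x" "x < 3" for x
  proof
    assume "\<exists>n. x + of_int n \<in> I"
    then obtain n :: int where n: "x + of_int n \<in> I" "\<bar>x + of_int n - a\<bar> < 1"
      using interval_translate_near[OF assms a] by metis
    have "n \<in> {\<lfloor>a\<rfloor> - 4..\<lfloor>a\<rfloor> + 2}" using n(2) x by simp linarith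
    then show "\<exists>n\<in>{\<lfloor>a\<rfloor> - 4..\<lfloor>a\<rfloor> + 2}. x + of_int n \<in> I" using n(1) by blast
  qed blast
  then show ?thesis by (intro that[of "{\<lfloor>a\<rfloor> - 4..\<lfloor>a\<rfloor> + 2}"]) auto
qed

definition turn :: "complex \<Rightarrow> real" where
  "turn z = Arg2pi z / (2 * pi)"

lemma polar_form: "z = of_real (norm z) * e (turn z)"
  using Arg2pi_eq[of z] by (simp add: turn_def e_def mult_ac)

lemma turn_bounds: "0 \<le> turn z" "turn z < 1"
  using Arg2pi_ge_0[of z] Arg2pi_lt_2pi[of z] by (simp_all add: turn_def)

text \<open>
The case \<open>s = 1\<close> accounts for the negative radii in \<open>I1\<close>: they are positive radii after a half turn.
\<close>

lemma mem_polar_rectangle: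
  assumes "\<rho> > 0"
  shows "of_real \<rho> * e t \<in> polar_rectangle I1 I2 \<longleftrightarrow>
     (\<exists>s\<in>{0, 1 :: nat}. (-1) ^ s * \<rho> \<in> I1 \<and> (\<exists>n::int. t + real s / 2 + of_int n \<in> I2))"
proof
  assume "of_real \<rho> * e t \<in> polar_rectangle I1 I2"
  then obtain r \<phi> where r: "of_real \<rho> * e t = of_real r * e \<phi>" "r \<in> I1" "\<phi> \<in> I2"
    by (auto simp: polar_rectangle_def)
  then have "norm (of_real \<rho> * e t) = norm (of_real r * e \<phi>)" by simp
  then have "\<rho> = \<bar>r\<bar>" using assms by (simp add: norm_mult)
  then consider "r = \<rho>" | "r = - \<rho>" by linarith
  then show "\<exists>s\<in>{0, 1 :: nat}. (-1) ^ s * \<rho> \<in> I1 \<and> (\<exists>n::int. t + real s / 2 + of_int n \<in> I2)"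
  proof cases
    case 1
    then have "e \<phi> = e t" using r(1) assms by simp
    then obtain n :: int where "\<phi> = t + of_int n" unfolding e_eq_iff by blast
    then show ?thesis using r 1 by auto
  next
    case 2
    then have "of_real \<rho> * (e \<phi> + e t) = 0" using r(1) by (simp add: algebra_simps)
    then have "e \<phi> = e (t + 1 / 2)" using assms by (simp add: e_half eq_neg_iff_add_eq_0)
    then obtain n :: int where "\<phi> = t + 1 / 2 + of_int n" unfolding e_eq_iff by blast
    then show ?thesis using r 2 by (intro bexI[of _ 1]) auto
  qed
next
  assume "\<exists>s\<in>{0, 1 :: nat}. (-1) ^ s * \<rho> \<in> I1 \<and> (\<exists>n::int. t + real s / 2 + of_int n \<in> I2)"
  then obtain s :: nat and n :: int
    where s: "s \<in> {0, 1}" "(-1) ^ s * \<rho> \<in> I1" "t + real s / 2 + of_int n \<in> I2" by blast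
  have "e (t + real s / 2 + of_int n) = e (t + real s / 2)" unfolding e_eq_iff by blast
  then have "of_real \<rho> * e t = of_real ((-1) ^ s * \<rho>) * e (t + real s / 2 + of_int n)"
    using s(1) by (auto simp: e_half)
  then show "of_real \<rho> * e t \<in> polar_rectangle I1 I2"
    unfolding polar_rectangle_def using s(2,3) by blast
qed

text \<open>
For nonzero values the modulus of the product is a multiple of the modulus of \<open>f p\<close> and its turn is a
translate of the turn of \<open>f p\<close>. So membership is a finite Boolean combination of conditions that place
a real function of \<open>p\<close> in an interval depending on \<open>w\<close>.
\<close>

lemma low_entropy_polar_rectangle:
  fixes f :: "nat \<Rightarrow> complex" and u :: "'w \<Rightarrow> complex"
  assumes "is_interval I1" "is_interval I2"
  shows "low_entropy (\<lambda>w p. f p * u w \<in> polar_rectangle I1 I2)"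
proof -
  let ?R = "polar_rectangle I1 I2"
  obtain S :: "int set" where S: "finite S"
    "\<And>x. 0 \<le> x \<Longrightarrow> x < 3 \<Longrightarrow> (\<exists>n. x + of_int n \<in> I2) \<longleftrightarrow> (\<exists>n\<in>S. x + of_int n \<in> I2)"
    by (rule interval_translates_finite[OF assms(2)]) blast
  define M where "M = (\<lambda>(s::nat) w p. norm (f p) \<in> {x. ((-1) ^ s * norm (u w)) * x + 0 \<in> I1})"
  define T where "T = (\<lambda>(s::nat) (n::int) w p. turn (f p) \<in> {x. 1 * x + (turn (u w) + real s / 2 + of_int n) \<in> I2})"
  have "low_entropy (M s)" for s
    unfolding M_def by (intro low_entropy_interval is_interval_affine_vimage assms)
  moreover have "low_entropy (T s n)" for s n
    unfolding T_def by (intro low_entropy_interval is_interval_affine_vimage assms)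
  ultimately have "low_entropy (\<lambda>w p. (f p \<noteq> 0 \<and> u w \<noteq> 0 \<and> (\<exists>s\<in>{0, 1}. M s w p \<and> (\<exists>n\<in>S. T s n w p)))
      \<or> ((f p = 0 \<or> u w = 0) \<and> 0 \<in> ?R))"
    by (intro low_entropy_disj low_entropy_conj low_entropy_finite_Ex low_entropy_const low_entropy_param S(1)) auto
  moreover have "f p * u w \<in> ?R \<longleftrightarrow>
      (f p \<noteq> 0 \<and> u w \<noteq> 0 \<and> (\<exists>s\<in>{0, 1}. M s w p \<and> (\<exists>n\<in>S. T s n w p))) \<or> ((f p = 0 \<or> u w = 0) \<and> 0 \<in> ?R)" for w p
  proof (cases "f p = 0 \<or> u w = 0")
    case False
    define t where "t = turn (f p) + turn (u w)"
    have t: "0 \<le> t + real s / 2" "t + real s / 2 < 3" if "s \<in> {0, 1}" for s :: nat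
      using that turn_bounds[of "f p"] turn_bounds[of "u w"] by (auto simp: t_def)
    have "f p * u w = of_real (norm (f p) * norm (u w)) * e t"
      using polar_form[of "f p"] polar_form[of "u w"] by (simp add: t_def e_add mult_ac)
    moreover have "norm (f p) * norm (u w) > 0" using False by simp
    ultimately have "f p * u w \<in> ?R \<longleftrightarrow> (\<exists>s\<in>{0, 1 :: nat}. (-1) ^ s * (norm (f p) * norm (u w)) \<in> I1 \<and> (\<exists>n::int. t + real s / 2 + of_int n \<in> I2))"
      by (simp only: mem_polar_rectangle)
    also have "\<dots> \<longleftrightarrow> (\<exists>s\<in>{0, 1}. M s w p \<and> (\<exists>n\<in>S. T s n w p))"
      by (intro bex_cong refl) (simp only: S(2)[OF t], simp add: M_def T_def t_def mult_ac add_ac)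
    finally show ?thesis using False by blast
  qed auto
  ultimately show ?thesis by simp
qed

section \<open>The three classes of level sets\<close>

lemma multiplicative_at_prime:
  assumes "multiplicative f" "prime p" "m > 0" "\<not> p dvd m"
  shows "f (p * m) = f p * f m"
  using assms prime_imp_coprime[of p m] prime_gt_0_nat[of p] by (simp add: multiplicative_def)

text \<open>
The hypotheses of the orthogonality criterion hold for all three classes. All primes are used for
\<open>D_infinity\<close> and \<open>E_pol\<close>. For \<open>E_cpt\<close> only the primes with \<open>f p = z\<close> are used, whose reciprocals have
a divergent sum by the definition of a concentration point; then \<open>f (p * m) = z * f m\<close> is the same for
all of them.
\<close>

lemma level_set_low_entropy:
  assumes "E \<in> D_infinity \<or> E \<in> E_cpt \<or> E \<in> E_pol"
  obtains \<P> :: "nat set" and Q :: "nat \<Rightarrow> nat \<Rightarrow> bool" where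
    "\<And>p. p \<in> \<P> \<Longrightarrow> prime p" "\<not> (\<lambda>p. 1 / real p) summable_on \<P>" "low_entropy Q"
    "\<And>m p. m > 0 \<Longrightarrow> p \<in> \<P> \<Longrightarrow> \<not> p dvd m \<Longrightarrow> p * m \<in> E \<longleftrightarrow> Q m p"
proof -
  from assms consider "E \<in> D_infinity" | "E \<in> E_cpt" | "E \<in> E_pol" by blast
  then show ?thesis
  proof cases
    case 1
    then obtain r :: nat and f :: "nat \<Rightarrow> nat \<Rightarrow> complex" and z :: "nat \<Rightarrow> complex"
      where f: "\<forall>i\<in>{1..r}. multiplicative (f i)"
      and E: "E = {n. n > 0 \<and> (\<forall>i\<in>{1..r}. f i n = z i)}"
      unfolding D_infinity_def D_class_def by blast
    show ?thesis
    proof (rule that[of "{p. prime p}" "\<lambda>m p. \<forall>i\<in>{1..r}. f i p * f i m = z i"])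
      show "low_entropy (\<lambda>m p. \<forall>i\<in>{1..r}. f i p * f i m = z i)"
        by (intro low_entropy_finite_All low_entropy_value) simp
      show "(p * m \<in> E) = (\<forall>i\<in>{1..r}. f i p * f i m = z i)"
        if "m > 0" "p \<in> {p. prime p}" "\<not> p dvd m" for m p
        using that f prime_gt_0_nat by (auto simp: E multiplicative_at_prime)
    qed (use primes_reciprocal_not_summable in auto)
  next
    case 2
    then obtain f K z where f: "multiplicative f" "concentration_point f z"
      and E: "E = {n. n > 0 \<and> f n \<in> K}"
      unfolding E_cpt_def by blast
    show ?thesis
    proof (rule that[of "{p. prime p \<and> f p = z}" "\<lambda>m p. z * f m \<in> K"])
      show "low_entropy (\<lambda>m p :: nat. z * f m \<in> K)" by (rule low_entropy_param)
      show "(p * m \<in> E) = (z * f m \<in> K)"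
        if "m > 0" "p \<in> {p. prime p \<and> f p = z}" "\<not> p dvd m" for m p
        using that f(1) prime_gt_0_nat by (auto simp: E multiplicative_at_prime)
    qed (use f(2) in \<open>auto simp: concentration_point_def\<close>)
  next
    case 3
    then obtain f K where f: "multiplicative f" and K: "elementary_polar K"
      and E: "E = {n. n > 0 \<and> f n \<in> K}"
      unfolding E_pol_def by blast
    from K obtain \<K> where \<K>: "finite \<K>" "K = \<Union>\<K>"
      "\<And>R. R \<in> \<K> \<Longrightarrow> \<exists>I1 I2. is_interval I1 \<and> is_interval I2 \<and> R = polar_rectangle I1 I2"
      unfolding elementary_polar_def by blast
    show ?thesis
    proof (rule that[of "{p. prime p}" "\<lambda>m p. \<exists>R\<in>\<K>. f p * f m \<in> R"])
      show "low_entropy (\<lambda>m p. \<exists>R\<in>\<K>. f p * f m \<in> R)"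
        using low_entropy_polar_rectangle \<K>(3) by (intro low_entropy_finite_Ex \<K>(1)) blast
      show "(p * m \<in> E) = (\<exists>R\<in>\<K>. f p * f m \<in> R)"
        if "m > 0" "p \<in> {p. prime p}" "\<not> p dvd m" for m p
        using that f prime_gt_0_nat by (auto simp: E \<K>(2) multiplicative_at_prime)
    qed (use primes_reciprocal_not_summable in auto)
  qed
qed

theorem corollary2:
  fixes E :: "nat set" and \<theta> :: real
  assumes "E \<in> D_infinity \<or> E \<in> E_cpt \<or> E \<in> E_pol"
    and "\<theta> \<notin> \<rat>"
  shows "(\<lambda>x::real. \<Sum>n | n > 0 \<and> real n \<le> x. indicator E n * e (\<theta> * real n))
           \<in> o[at_top](\<lambda>x. complex_of_real x)"
proof (rule level_set_low_entropy[OF assms(1)])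
  fix \<P> :: "nat set" and Q :: "nat \<Rightarrow> nat \<Rightarrow> bool"
  assume "\<And>p. p \<in> \<P> \<Longrightarrow> prime p" "\<not> (\<lambda>p. 1 / real p) summable_on \<P>" "low_entropy Q"
    and "\<And>m p. m > 0 \<Longrightarrow> p \<in> \<P> \<Longrightarrow> \<not> p dvd m \<Longrightarrow> p * m \<in> E \<longleftrightarrow> Q m p"
  note criterion = exponential_sum_criterion[OF assms(2) this]
  show ?thesis by (rule exponential_sum_smalloI) (rule criterion)
qed

end
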